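(* Let $E$ and $\widetilde E$ be energy forms on $L^0(m)$ such that $\widetilde E$ is an extension of $E$. The following assertions are equivalent. (i) $D(E)$ is an order ideal in $D(\widetilde E)$. (ii) $D(E)\cap L^\infty(m)$ is an algebraic ideal in $D(\widetilde E)\cap L^\infty(m)$. (iii) $D(\widetilde E)\subseteq D(E)_{\rm loc}$. (iv) There exists a special $E$-nest $\mathcal N$ such that $D(\widetilde E)\cap L^\infty(m)\subseteq D(E)_{{\rm loc},\mathcal N}$. (v) For all special $E$-nests $\mathcal N$ we have $D(\widetilde E)\cap L^\infty(m)\subseteq D(E)_{{\rm loc},\mathcal N}$.
   Context: $(X,\mathcal B,m)$ is a measure space with $m$ localizable: $m$ is semi-finite and every family $\mathcal A\subseteq\mathcal B$ has an essential supremum $S\in\mathcal B$, i.e. $m(A\setminus S)=0$ for all $A\in\mathcal A$, and $m(S\setminus G)=0$ whenever $G\in\mathcal B$ satisfies $m(A\setminus G)=0$ for all $A\in\mathcal A$. $L^0(m)$ is the space of real-valued measurable functions modulo $m$-a.e. equality, with the topology $\tau(m)$ of local convergence in measure: $f_i\to f$ iff $\int_U|f_i-f|\wedge1\,dm\to0$ for every measurable $U$ with $m(U)<\infty$. A quadratic form on $L^0(m)$ is a map $q:L^0(m)\to[0,\infty]$ with $2q(u)+2q(v)=q(u+v)+q(u-v)$ and $q(\lambda u)=|\lambda|^2q(u)$ ($0\cdot\infty=0$); $D(q)=\{q<\infty\}$. The form topology on $D(q)$ is the smallest topology containing the subspace topology of $\tau(m)$ and the topology of the seminorm $q^{1/2}$;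 $q$ is closed if $D(q)$ is complete in the form topology. $\tilde q$ is an extension of $q$ if $D(q)\subseteq D(\tilde q)$ and $\tilde q=q$ on $D(q)$. An $\varepsilon$-cutoff is a monotone increasing map $C:\mathbb R\to[-\varepsilon,1+\varepsilon]$ with $|C(x)-C(y)|\le|x-y|$ and $C(x)=x$ for $x\in[0,1]$. A quadratic form $E$ on $L^0(m)$ is Markovian if for each $\varepsilon>0$ there is an $\varepsilon$-cutoff $C_\varepsilon$ with $E(C_\varepsilon\circ f)\le E(f)$ for all $f\in L^0(m)$; an energy form is a closed Markovian form on $L^0(m)$. For $A,B\subseteq L^0(m)$: $A$ is an order ideal in $B$ if $f\in A$, $g\in B$, $|g|\le|f|$ imply $g\in A$; $A$ is an algebraic ideal in $B$ if $fg\in A$ for all $f\in A$, $g\in B$. An $E$-nest is a collection $\mathcal N$ of measurable sets such that $D(E)_{\mathcal N}=\{f\in D(E): \exists N\in\mathcal N,\ f1_{X\setminus N}=0\}$ is a dense subspace of $D(E)$ with respect to the form topology. It is special if for each $N\in\mathcal N$ there is $g_N\in D(E)_{\mathcal N}$ with $g_N\ge1_N$. $D(E)_{{\rm loc},\mathcal N}=\{f\in L^0(m): \forall N\in\mathcal N\ \exists f_N\in D(E)\text{ with }f1_N=f_N1_N\}$, and $D(E)_{\rm loc}$ is the union of $D(E)_{{\rm loc},\mathcal N}$ over all $E$-nests $\mathcal N$. *)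

theory Defs
  imports "HOL-Analysis.Analysis"
begin

section \<open>Localizable measures\<close>

definition semifinite_measure :: "'a measure \<Rightarrow> bool" where
  "semifinite_measure M \<longleftrightarrow>
     (\<forall>A\<in>sets M. emeasure M A = \<infinity> \<longrightarrow>
        (\<exists>B\<in>sets M. B \<subseteq> A \<and> 0 < emeasure M B \<and> emeasure M B < \<infinity>))"

definition is_ess_sup_family :: "'a measure \<Rightarrow> 'a set set \<Rightarrow> 'a set \<Rightarrow> bool" where
  "is_ess_sup_family M \<A> S \<longleftrightarrow>
     S \<in> sets M \<and>
     (\<forall>A\<in>\<A>. emeasure M (A - S) = 0) \<and>
     (\<forall>G\<in>sets M. (\<forall>A\<in>\<A>. emeasure M (A - G) = 0) \<longrightarrow> emeasure M (S - G) = 0)"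

definition localizable :: "'a measure \<Rightarrow> bool" where
  "localizable M \<longleftrightarrow>
     semifinite_measure M \<and> (\<forall>\<A>\<subseteq>sets M. \<exists>S. is_ess_sup_family M \<A> S)"

section \<open>The space of measurable functions and local convergence in measure\<close>

text \<open>
  Elements of \<open>L\<^sup>0(M)\<close> are handled through representatives: \<open>L0 M\<close> is the set of measurable
  real-valued functions, every (in)equality between elements is required almost everywhere, and
  functionals on \<open>L\<^sup>0(M)\<close> are required to be constant on almost-everywhere classes. The topologies
  below live on representatives and are the pullbacks of those on the quotient; all
  sets of functions whose density or completeness is considered are unions of
  almost-everywhere classes, so both notions agree with those on the quotient.
\<close>

abbreviation L0 :: "'a measure \<Rightarrow> ('a \<Rightarrow> real) set" where
  "L0 M \<equiv> borel_measurable M"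

definition Linf :: "'a measure \<Rightarrow> ('a \<Rightarrow> real) set" where
  "Linf M = {f \<in> L0 M. \<exists>c. AE x in M. \<bar>f x\<bar> \<le> c}"

definition loc_dist :: "'a measure \<Rightarrow> 'a set \<Rightarrow> ('a \<Rightarrow> real) \<Rightarrow> ('a \<Rightarrow> real) \<Rightarrow> real" where
  "loc_dist M U f g = (LINT x:U|M. min \<bar>f x - g x\<bar> 1)"

text \<open>
  The topology \<open>\<tau>(M)\<close> is generated by the balls of the pseudometrics \<open>loc_dist M U\<close> with \<open>U\<close> of
  finite measure; \<open>limitin_loc_measure_topology\<close> below shows that it has the
  prescribed convergence.
\<close>

definition loc_measure_topology :: "'a measure \<Rightarrow> ('a \<Rightarrow> real) topology" where
  "loc_measure_topology M = topology_generated_by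
     {{g \<in> L0 M. loc_dist M U g f < r} | U f r.
        U \<in> sets M \<and> emeasure M U < \<infinity> \<and> f \<in> L0 M \<and> r > 0}"

lemma integrable_loc_dist:
  assumes "U \<in> sets M" "emeasure M U < \<infinity>" "f \<in> L0 M" "g \<in> L0 M"
  shows "set_integrable M U (\<lambda>x. min \<bar>f x - g x\<bar> (1::real))"
proof -
  have [measurable]: "f \<in> borel_measurable M" "g \<in> borel_measurable M" "U \<in> sets M"
    using assms by auto
  have "integrable M (indicator U :: 'a \<Rightarrow> real)"
    using assms by simp
  then show ?thesis
    unfolding set_integrable_def
    by (rule Bochner_Integration.integrable_bound) (auto simp: indicator_def)
qed

lemma loc_dist_triangle:
  assumes "U \<in> sets M" "emeasure M U < \<infinity>" "f \<in> L0 M" "g \<in> L0 M" "h \<in> L0 M"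
  shows "loc_dist M U f h \<le> loc_dist M U f g + loc_dist M U g h"
proof -
  note i = integrable_loc_dist[OF assms(1,2)]
  have "loc_dist M U f h \<le> (LINT x:U|M. min \<bar>f x - g x\<bar> 1 + min \<bar>g x - h x\<bar> 1)"
    unfolding loc_dist_def
    by (rule set_integral_mono) (use assms in \<open>auto intro!: i set_integral_add\<close>)
  also have "\<dots> = loc_dist M U f g + loc_dist M U g h"
    unfolding loc_dist_def by (rule set_integral_add) (use assms in \<open>auto intro!: i\<close>)
  finally show ?thesis .
qed

lemma loc_dist_self [simp]: "loc_dist M U f f = 0"
  by (simp add: loc_dist_def)

lemma loc_dist_nonneg: "0 \<le> loc_dist M U f g"
  unfolding loc_dist_def set_lebesgue_integral_def
  by (intro Bochner_Integration.integral_nonneg) (auto simp: indicator_def)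

lemma topspace_loc_measure_topology [simp]: "topspace (loc_measure_topology M) = L0 M"
proof -
  have "\<exists>B. B \<in> {{g \<in> L0 M. loc_dist M U g f < r} | U f r.
        U \<in> sets M \<and> emeasure M U < \<infinity> \<and> f \<in> L0 M \<and> r > 0} \<and> h \<in> B" if "h \<in> L0 M" for h
    using that
    by (intro exI[of _ "{g \<in> L0 M. loc_dist M {} g h < 1}"] conjI CollectI
        exI[of _ "{}"] exI[of _ h] exI[of _ 1]) auto
  then show ?thesis
    unfolding loc_measure_topology_def topology_generated_by_topspace by fastforce
qed

lemma limitin_loc_measure_topology:
  "limitin (loc_measure_topology M) f l F \<longleftrightarrow>
     l \<in> L0 M \<and> (\<forall>\<^sub>F i in F. f i \<in> L0 M) \<and>
     (\<forall>U\<in>sets M. emeasure M U < \<infinity> \<longrightarrow>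
        ((\<lambda>i. LINT x:U|M. min \<bar>f i x - l x\<bar> 1) \<longlongrightarrow> 0) F)"
proof (intro iffI conjI ballI impI)
  assume lim: "limitin (loc_measure_topology M) f l F"
  show l: "l \<in> L0 M"
    using limitin_topspace[OF lim] by simp
  show "\<forall>\<^sub>F i in F. f i \<in> L0 M"
    using lim unfolding limitin_def
    by (metis openin_topspace topspace_loc_measure_topology)
  fix U assume U: "U \<in> sets M" "emeasure M U < \<infinity>"
  have "\<forall>\<^sub>F i in F. dist (loc_dist M U (f i) l) 0 < e" if "e > 0" for e
  proof -
    have "openin (loc_measure_topology M) {g \<in> L0 M. loc_dist M U g l < e}"
      unfolding loc_measure_topology_def
      by (rule topology_generated_by_Basis) (use U l that in blast)
    then have "\<forall>\<^sub>F i in F. f i \<in> {g \<in> L0 M. loc_dist M U g l < e}"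
      using lim l that unfolding limitin_def by auto
    then show ?thesis
      by eventually_elim (auto simp: dist_real_def loc_dist_nonneg)
  qed
  then show "((\<lambda>i. LINT x:U|M. min \<bar>f i x - l x\<bar> 1) \<longlongrightarrow> 0) F"
    unfolding loc_dist_def[symmetric] tendsto_iff by blast
next
  let ?B = "{{g \<in> L0 M. loc_dist M U g f < r} | U f r.
        U \<in> sets M \<and> emeasure M U < \<infinity> \<and> f \<in> L0 M \<and> r > 0}"
  assume A: "l \<in> L0 M \<and> (\<forall>\<^sub>F i in F. f i \<in> L0 M) \<and>
     (\<forall>U\<in>sets M. emeasure M U < \<infinity> \<longrightarrow>
        ((\<lambda>i. LINT x:U|M. min \<bar>f i x - l x\<bar> 1) \<longlongrightarrow> 0) F)"
  have "l \<in> V \<longrightarrow> (\<forall>\<^sub>F i in F. f i \<in> V)" if "generate_topology_on ?B V" for V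
    using that
  proof induction
    case Empty
    then show ?case by simp
  next
    case (Int a b)
    then show ?case by (auto intro: eventually_conj)
  next
    case (UN K)
    show ?case
    proof
      assume "l \<in> \<Union>K"
      then obtain k where k: "k \<in> K" "l \<in> k" by blast
      then have "\<forall>\<^sub>F i in F. f i \<in> k" using UN by blast
      then show "\<forall>\<^sub>F i in F. f i \<in> \<Union>K"
        by eventually_elim (use k in blast)
    qed
  next
    case (Basis s)
    then obtain U h r where s: "s = {g \<in> L0 M. loc_dist M U g h < r}"
      and U: "U \<in> sets M" "emeasure M U < \<infinity>" and h: "h \<in> L0 M" by blast
    show ?case
    proof
      assume ls: "l \<in> s"
      then have "0 < r - loc_dist M U l h" by (simp add: s)
      moreover have "((\<lambda>i. loc_dist M U (f i) l) \<longlongrightarrow> 0) F"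
        using A U by (auto simp: loc_dist_def)
      ultimately have "\<forall>\<^sub>F i in F. loc_dist M U (f i) l < r - loc_dist M U l h"
        by (simp add: order_tendstoD(2))
      moreover have "\<forall>\<^sub>F i in F. f i \<in> L0 M" using A by blast
      ultimately show "\<forall>\<^sub>F i in F. f i \<in> s"
      proof eventually_elim
        case (elim i)
        then show ?case
          using loc_dist_triangle[OF U, of "f i" l h] A h by (auto simp: s)
      qed
    qed
  qed
  then show "limitin (loc_measure_topology M) f l F"
    using A unfolding limitin_def topspace_loc_measure_topology
    by (auto simp: loc_measure_topology_def openin_topology_generated_by_iff)
qed

section \<open>Quadratic forms and energy forms\<close>

text \<open>Only the values of a form on \<open>L0 M\<close> matter.\<close>

definition quadratic_form :: "'a measure \<Rightarrow> (('a \<Rightarrow> real) \<Rightarrow> ennreal) \<Rightarrow> bool" where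
  "quadratic_form M q \<longleftrightarrow>
     (\<forall>u\<in>L0 M. \<forall>v\<in>L0 M. (AE x in M. u x = v x) \<longrightarrow> q u = q v) \<and>
     (\<forall>u\<in>L0 M. \<forall>v\<in>L0 M. 2 * q u + 2 * q v = q (\<lambda>x. u x + v x) + q (\<lambda>x. u x - v x)) \<and>
     (\<forall>u\<in>L0 M. \<forall>c. q (\<lambda>x. c * u x) = ennreal (\<bar>c\<bar>\<^sup>2) * q u)"

definition form_domain :: "'a measure \<Rightarrow> (('a \<Rightarrow> real) \<Rightarrow> ennreal) \<Rightarrow> ('a \<Rightarrow> real) set" where
  "form_domain M q = {f \<in> L0 M. q f < \<infinity>}"

definition form_seminorm :: "(('a \<Rightarrow> real) \<Rightarrow> ennreal) \<Rightarrow> ('a \<Rightarrow> real) \<Rightarrow> real" where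
  "form_seminorm q f = sqrt (enn2real (q f))"

definition seminorm_topology ::
  "'a measure \<Rightarrow> (('a \<Rightarrow> real) \<Rightarrow> ennreal) \<Rightarrow> ('a \<Rightarrow> real) topology" where
  "seminorm_topology M q = topology_generated_by
     {{g \<in> form_domain M q. form_seminorm q (\<lambda>x. g x - f x) < r} | f r.
        f \<in> form_domain M q \<and> r > 0}"

definition form_topology ::
  "'a measure \<Rightarrow> (('a \<Rightarrow> real) \<Rightarrow> ennreal) \<Rightarrow> ('a \<Rightarrow> real) topology" where
  "form_topology M q = topology_generated_by
     ({V. openin (subtopology (loc_measure_topology M) (form_domain M q)) V} \<union>
      {V. openin (seminorm_topology M q) V})"

text \<open>
  The form topology is a vector space topology that need not be first countable, so completeness
  is expressed with Cauchy filters for the translation-invariant uniformity.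
\<close>

definition cauchy_filter_in :: "('a \<Rightarrow> real) topology \<Rightarrow> ('a \<Rightarrow> real) filter \<Rightarrow> bool" where
  "cauchy_filter_in T F \<longleftrightarrow>
     F \<noteq> bot \<and> F \<le> principal (topspace T) \<and>
     (\<forall>W. openin T W \<and> (\<lambda>x. 0) \<in> W \<longrightarrow> (\<forall>\<^sub>F (f, g) in F \<times>\<^sub>F F. (\<lambda>x. f x - g x) \<in> W))"

definition complete_tvs :: "('a \<Rightarrow> real) topology \<Rightarrow> bool" where
  "complete_tvs T \<longleftrightarrow> (\<forall>F. cauchy_filter_in T F \<longrightarrow> (\<exists>f. limitin T (\<lambda>g. g) f F))"

definition closed_form :: "'a measure \<Rightarrow> (('a \<Rightarrow> real) \<Rightarrow> ennreal) \<Rightarrow> bool" where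
  "closed_form M q \<longleftrightarrow> complete_tvs (form_topology M q)"

definition form_extension ::
  "'a measure \<Rightarrow> (('a \<Rightarrow> real) \<Rightarrow> ennreal) \<Rightarrow> (('a \<Rightarrow> real) \<Rightarrow> ennreal) \<Rightarrow> bool" where
  "form_extension M q q' \<longleftrightarrow>
     form_domain M q \<subseteq> form_domain M q' \<and> (\<forall>f\<in>form_domain M q. q' f = q f)"

definition cutoff :: "real \<Rightarrow> (real \<Rightarrow> real) \<Rightarrow> bool" where
  "cutoff \<epsilon> C \<longleftrightarrow>
     mono C \<and> (\<forall>x. C x \<in> {-\<epsilon>..1 + \<epsilon>}) \<and> (\<forall>x y. \<bar>C x - C y\<bar> \<le> \<bar>x - y\<bar>) \<and> (\<forall>x\<in>{0..1}. C x = x)"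

definition markovian_form :: "'a measure \<Rightarrow> (('a \<Rightarrow> real) \<Rightarrow> ennreal) \<Rightarrow> bool" where
  "markovian_form M E \<longleftrightarrow>
     quadratic_form M E \<and>
     (\<forall>\<epsilon>>0. \<exists>C. cutoff \<epsilon> C \<and> (\<forall>f\<in>L0 M. E (C \<circ> f) \<le> E f))"

definition energy_form :: "'a measure \<Rightarrow> (('a \<Rightarrow> real) \<Rightarrow> ennreal) \<Rightarrow> bool" where
  "energy_form M E \<longleftrightarrow> markovian_form M E \<and> closed_form M E"

section \<open>Ideals, nests and local domains\<close>

definition order_ideal_in ::
  "'a measure \<Rightarrow> ('a \<Rightarrow> real) set \<Rightarrow> ('a \<Rightarrow> real) set \<Rightarrow> bool" where
  "order_ideal_in M A B \<longleftrightarrow> (\<forall>f\<in>A. \<forall>g\<in>B. (AE x in M. \<bar>g x\<bar> \<le> \<bar>f x\<bar>) \<longrightarrow> g \<in> A)"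

definition algebraic_ideal_in :: "('a \<Rightarrow> real) set \<Rightarrow> ('a \<Rightarrow> real) set \<Rightarrow> bool" where
  "algebraic_ideal_in A B \<longleftrightarrow> (\<forall>f\<in>A. \<forall>g\<in>B. (\<lambda>x. f x * g x) \<in> A)"

definition linear_subspace :: "('a \<Rightarrow> real) set \<Rightarrow> bool" where
  "linear_subspace V \<longleftrightarrow>
     (\<lambda>x. 0) \<in> V \<and> (\<forall>f\<in>V. \<forall>g\<in>V. (\<lambda>x. f x + g x) \<in> V) \<and> (\<forall>c. \<forall>f\<in>V. (\<lambda>x. c * f x) \<in> V)"

definition nest_domain ::
  "'a measure \<Rightarrow> (('a \<Rightarrow> real) \<Rightarrow> ennreal) \<Rightarrow> 'a set set \<Rightarrow> ('a \<Rightarrow> real) set" where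
  "nest_domain M E \<N> =
     {f \<in> form_domain M E. \<exists>N\<in>\<N>. AE x in M. f x * indicator (space M - N) x = 0}"

definition form_nest :: "'a measure \<Rightarrow> (('a \<Rightarrow> real) \<Rightarrow> ennreal) \<Rightarrow> 'a set set \<Rightarrow> bool" where
  "form_nest M E \<N> \<longleftrightarrow>
     \<N> \<subseteq> sets M \<and> linear_subspace (nest_domain M E \<N>) \<and>
     form_topology M E closure_of nest_domain M E \<N> = form_domain M E"

definition special_nest :: "'a measure \<Rightarrow> (('a \<Rightarrow> real) \<Rightarrow> ennreal) \<Rightarrow> 'a set set \<Rightarrow> bool" where
  "special_nest M E \<N> \<longleftrightarrow>
     form_nest M E \<N> \<and> (\<forall>N\<in>\<N>. \<exists>g\<in>nest_domain M E \<N>. AE x in M. g x \<ge> indicator N x)"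

definition local_domain_nest ::
  "'a measure \<Rightarrow> (('a \<Rightarrow> real) \<Rightarrow> ennreal) \<Rightarrow> 'a set set \<Rightarrow> ('a \<Rightarrow> real) set" where
  "local_domain_nest M E \<N> =
     {f \<in> L0 M. \<forall>N\<in>\<N>. \<exists>h\<in>form_domain M E.
        AE x in M. f x * indicator N x = h x * indicator N x}"

definition local_domain ::
  "'a measure \<Rightarrow> (('a \<Rightarrow> real) \<Rightarrow> ennreal) \<Rightarrow> ('a \<Rightarrow> real) set" where
  "local_domain M E = (\<Union>\<N>\<in>{\<N>. form_nest M E \<N>}. local_domain_nest M E \<N>)"

end

theory Submission
  imports Defs
begin

text \<open>
  The engine is lower semicontinuity of an energy form with respect to local convergence in measure.
  Since \<open>L\<^sup>0\<close> is not locally convex it cannot be obtained from closedness by passing to convex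
  combinations directly; instead, an energy-minimizing filter on a directed family of convex sets
  shrinking to \<open>u\<close> is Cauchy by the parallelogram identity, and the Markov property supplies convex
  families: first small uniform balls around a clamped function, then functions agreeing with \<open>u\<close>
  where \<open>\<bar>u\<bar> \<le> n\<close>, and finally \<open>L\<^sup>1\<close>-balls of truncated functions.

  Given this, elements of the small domain are approximated by truncations whose energies do not
  exceed the limit's, which forces strong convergence and yields the required nests. Conversely, if
  \<open>0 \<le> g \<le> \<bar>f\<bar>\<close>, with \<open>f\<close> in the small domain and \<open>g\<close> locally in it, then \<open>g\<close> is a limit of the minima
  of \<open>g\<close> with \<open>\<bar>f'\<bar>\<close>, where \<open>f'\<close> is supported in a set of the nest and close to \<open>f\<close>.
\<close>

text \<open>The obstacle is a circle. That clamping does not raise the energy should follow from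
  \<open>E (C \<circ> f) \<le> E f\<close> by letting \<epsilon> tend to 0, which is lower
  semicontinuity; but this becomes provable only after truncation, since balls of
  \<open>loc_dist\<close> need not be convex. The way out is that \<open>C \<circ> f\<close> lies
  within \<epsilon> of the clamped function, and uniform balls are convex already. Clamps to [0, a]
  do not yield the truncation to [-n, n] directly, as this interval is not a multiple of [0, 1]. The
  gap is bridged by a sign of the bilinear form: if u is recovered from u + t v, for every t > 0, by
  a map that does not raise the energy, then \<open>B u v\<close> is nonnegative, so dropping v from
  u + v cannot raise the energy either. The same inequality controls the tent map behind products.
  Filters replace sequences because the neighbourhoods are indexed by all sets of finite measure, so
  the form topology need not be first countable.\<close>

lemma additive_bounded_imp_linear:
  fixes g :: "real \<Rightarrow> real"
  assumes add: "\<And>s t. g (s + t) = g s + g t"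
    and bounded: "\<And>t. 0 \<le> t \<Longrightarrow> t \<le> 1 \<Longrightarrow> \<bar>g t\<bar> \<le> C"
  shows "g t = t * g 1"
proof -
  \<comment> \<open>Removing the linear part makes \<open>k\<close> vanish on the integers, hence
    1-periodic and bounded on the whole line; a bounded additive function is 0, since
    \<open>k (n * t)\<close> grows like n.\<close>
  define k where "k t = g t - t * g 1" for t
  have k_add: "k (s + t) = k s + k t" for s t
    by (simp add: k_def add algebra_simps)
  have k_nat: "k (real n * t) = real n * k t" for n t
  proof (induction n)
    case 0
    then show ?case using k_add[of 0 0] by simp
  next
    case (Suc n)
    then show ?case using k_add[of "real n * t" t] by (simp add: algebra_simps)
  qed
  have k0: "k 0 = 0" using k_add[of 0 0] by simp
  have k_minus: "k (- t) = - k t" for t using k_add[of t "- t"] k0 by simp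
  have k_int: "k (of_int z) = 0" for z
  proof (cases z)
    case (nonneg n)
    then show ?thesis using k_nat[of n 1] by (simp add: k_def)
  next
    case (neg n)
    then have "of_int z = - (real (Suc n) * 1)" by simp
    then have "k (of_int z) = - (real (Suc n) * k 1)" by (simp only: k_minus k_nat)
    then show ?thesis by (simp add: k_def)
  qed
  have k_bounded: "\<bar>k t\<bar> \<le> C + \<bar>g 1\<bar>" for t
  proof -
    have "k t = k (frac t)"
      using k_add[of "of_int \<lfloor>t\<rfloor>" "frac t"] k_int by (simp add: frac_def)
    moreover have "\<bar>g (frac t)\<bar> \<le> C"
      by (rule bounded) (auto simp: frac_ge_0 frac_lt_1 less_imp_le)
    moreover have "\<bar>frac t * g 1\<bar> \<le> 1 * \<bar>g 1\<bar>"
      unfolding abs_mult by (rule mult_right_mono) (auto simp: frac_ge_0 frac_lt_1 less_imp_le)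
    ultimately show ?thesis unfolding k_def by linarith
  qed
  have "k t = 0"
  proof (rule ccontr)
    assume "k t \<noteq> 0"
    then obtain n where "real n * \<bar>k t\<bar> > C + \<bar>g 1\<bar>"
      using reals_Archimedean3[of "\<bar>k t\<bar>"] by auto
    then show False using k_bounded[of "real n * t"] by (simp add: k_nat abs_mult)
  qed
  then show ?thesis by (simp add: k_def)
qed

text \<open>The linear term dominates as t tends to 0 from above. This is the first-order condition
  behind \<open>B_nonnegI\<close>.\<close>

lemma quadratic_nonneg_imp_linear_nonneg:
  fixes b c :: real
  assumes "\<And>t. 0 < t \<Longrightarrow> 0 \<le> t * b + t\<^sup>2 * c"
  shows "0 \<le> b"
proof (rule ccontr)
  assume "\<not> 0 \<le> b"
  \<comment> \<open>With this t, \<open>t * c\<close> is at most \<open>- b / 2\<close>, so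
    \<open>b + t * c\<close> is still negative; the summand 1 keeps the denominator positive when c
    is 0.\<close>
  define t where "t = - b / (2 * (\<bar>c\<bar> + 1))"
  have t: "0 < t" using \<open>\<not> 0 \<le> b\<close> by (simp add: t_def divide_pos_pos divide_neg_pos)
  have "0 \<le> t * (b + t * c)"
    using assms[OF t] by (simp add: power2_eq_square algebra_simps)
  then have "0 \<le> b + t * c" using t by (simp add: zero_le_mult_iff)
  moreover have "t * c \<le> t * (\<bar>c\<bar> + 1)" using t by (intro mult_left_mono) auto
  moreover have "t * (\<bar>c\<bar> + 1) = - b / 2"
    unfolding t_def by (simp add: field_simps add_nonneg_eq_0_iff)
  ultimately show False using \<open>\<not> 0 \<le> b\<close> by linarith
qed

section \<open>The bilinear form\<close>

locale quadratic =
  fixes M :: "'a measure" and E :: "('a \<Rightarrow> real) \<Rightarrow> ennreal"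
  assumes quadratic: "quadratic_form M E"
begin

abbreviation "D \<equiv> form_domain M E"
text \<open>\<open>enn2real\<close> sends \<infinity> to 0, so \<open>Q\<close> and
  \<open>nrm\<close> carry information only on \<open>D\<close>; membership in \<open>D\<close> has
  to be tracked separately.\<close>

abbreviation "Q u \<equiv> enn2real (E u)"
abbreviation "nrm \<equiv> form_seminorm E"

lemma D_measurable [measurable_dest]: "u \<in> D \<Longrightarrow> u \<in> borel_measurable M"
  by (simp add: form_domain_def)

lemma D_finite: "u \<in> D \<Longrightarrow> E u < top"
  by (simp add: form_domain_def)

lemma E_eq: "u \<in> D \<Longrightarrow> E u = ennreal (Q u)"
  by (simp add: form_domain_def)

lemma D_I: "u \<in> borel_measurable M \<Longrightarrow> E u \<le> K \<Longrightarrow> K < \<infinity> \<Longrightarrow> u \<in> D"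
  by (auto simp: form_domain_def)

lemma E_cong:
  assumes "u \<in> borel_measurable M" "v \<in> borel_measurable M" "AE x in M. u x = v x"
  shows "E u = E v"
  using quadratic assms unfolding quadratic_form_def by blast

lemma D_cong:
  assumes "u \<in> D" "v \<in> borel_measurable M" "AE x in M. u x = v x"
  shows "v \<in> D"
  using assms E_cong[of u v] by (auto simp: form_domain_def)

lemma E_parallelogram:
  assumes "u \<in> borel_measurable M" "v \<in> borel_measurable M"
  shows "2 * E u + 2 * E v = E (\<lambda>x. u x + v x) + E (\<lambda>x. u x - v x)"
  using quadratic assms unfolding quadratic_form_def by blast

lemma E_scale: "u \<in> borel_measurable M \<Longrightarrow> E (\<lambda>x. c * u x) = ennreal (\<bar>c\<bar>\<^sup>2) * E u"
  using quadratic unfolding quadratic_form_def by blast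

lemma E_uminus: "u \<in> borel_measurable M \<Longrightarrow> E (\<lambda>x. - u x) = E u"
  using E_scale[of u "-1"] by simp

lemma E_zero: "E (\<lambda>x. 0) = 0"
  using E_scale[of "\<lambda>x. 0" 0] by simp

lemma D_zero: "(\<lambda>x. 0) \<in> D"
  by (simp add: form_domain_def E_zero)

lemma D_scale: "u \<in> D \<Longrightarrow> (\<lambda>x. c * u x) \<in> D"
  by (auto simp: form_domain_def E_scale ennreal_mult_less_top)

lemma Q_scale: "u \<in> D \<Longrightarrow> Q (\<lambda>x. c * u x) = c\<^sup>2 * Q u"
  by (simp add: E_scale D_measurable enn2real_mult)

lemma
  assumes "u \<in> D" "v \<in> D"
  shows D_add: "(\<lambda>x. u x + v x) \<in> D" and D_diff: "(\<lambda>x. u x - v x) \<in> D"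
proof -
  note [measurable] = assms[THEN D_measurable]
  have "2 * E u + 2 * E v < \<infinity>"
    using assms by (auto simp: form_domain_def ennreal_mult_less_top)
  then have "E (\<lambda>x. u x + v x) + E (\<lambda>x. u x - v x) < \<infinity>"
    using E_parallelogram[of u v] by simp
  then show "(\<lambda>x. u x + v x) \<in> D" "(\<lambda>x. u x - v x) \<in> D"
    by (auto simp: form_domain_def)
qed

lemma D_uminus: "u \<in> D \<Longrightarrow> (\<lambda>x. - u x) \<in> D"
  using D_scale[of u "-1"] by simp

lemma Q_uminus: "u \<in> D \<Longrightarrow> Q (\<lambda>x. - u x) = Q u"
  by (simp add: E_uminus D_measurable)

lemma Q_parallelogram:
  assumes "u \<in> D" "v \<in> D"
  shows "2 * Q u + 2 * Q v = Q (\<lambda>x. u x + v x) + Q (\<lambda>x. u x - v x)"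
proof -
  have "enn2real (2 * E u + 2 * E v) = enn2real (E (\<lambda>x. u x + v x) + E (\<lambda>x. u x - v x))"
    using assms by (simp add: E_parallelogram D_measurable)
  then show ?thesis
    using assms D_finite[OF D_add[OF assms]] D_finite[OF D_diff[OF assms]]
    by (simp add: enn2real_plus enn2real_mult D_finite ennreal_mult_less_top)
qed

text \<open>Polarization with the sum only: \<open>Q_add\<close> then holds for all u and v by
  definition, and the parallelogram law is spent on bilinearity alone.\<close>

definition B where "B u v = (Q (\<lambda>x. u x + v x) - Q u - Q v) / 2"

lemma Q_add: "Q (\<lambda>x. u x + v x) = Q u + 2 * B u v + Q v"
  by (simp add: B_def field_simps)

lemma B_commute: "B u v = B v u"
  by (simp add: B_def add.commute)

text \<open>The Jordan-von Neumann argument: the third parallelogram cancels the terms in u + w - v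
  and u + v - w of the first two, and the fourth trades \<open>Q (v - w)\<close> for
  \<open>Q (v + w)\<close>.\<close>

lemma B_add_right:
  assumes "u \<in> D" "v \<in> D" "w \<in> D"
  shows "B u (\<lambda>x. v x + w x) = B u v + B u w"
proof -
  note D_intros = D_add D_diff assms
  have "2 * Q (\<lambda>x. u x + w x) + 2 * Q v = Q (\<lambda>x. u x + w x + v x) + Q (\<lambda>x. u x + w x - v x)"
    by (rule Q_parallelogram) (intro D_intros)+
  moreover have "2 * Q (\<lambda>x. u x + v x) + 2 * Q w = Q (\<lambda>x. u x + v x + w x) + Q (\<lambda>x. u x + v x - w x)"
    by (rule Q_parallelogram) (intro D_intros)+
  moreover have "2 * Q u + 2 * Q (\<lambda>x. v x - w x) = Q (\<lambda>x. u x + (v x - w x)) + Q (\<lambda>x. u x - (v x - w x))"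
    by (rule Q_parallelogram) (intro D_intros)+
  moreover have "2 * Q v + 2 * Q w = Q (\<lambda>x. v x + w x) + Q (\<lambda>x. v x - w x)"
    by (rule Q_parallelogram) (intro D_intros)+
  moreover have "(\<lambda>x. u x + w x + v x) = (\<lambda>x. u x + (v x + w x))"
    "(\<lambda>x. u x + v x + w x) = (\<lambda>x. u x + (v x + w x))"
    "(\<lambda>x. u x + (v x - w x)) = (\<lambda>x. u x + v x - w x)"
    "(\<lambda>x. u x - (v x - w x)) = (\<lambda>x. u x + w x - v x)"
    by (auto simp: algebra_simps)
  ultimately show ?thesis
    by (simp add: B_def field_simps)
qed

text \<open>Additivity alone would allow wild solutions of Cauchy's functional equation. The
  parallelogram law bounds \<open>Q (u + t v)\<close> for t in [0, 1], and boundedness excludes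
  them.\<close>

lemma B_scale_right:
  assumes "u \<in> D" "v \<in> D"
  shows "B u (\<lambda>x. t * v x) = t * B u v"
proof -
  have "B u (\<lambda>x. t * v x) = t * B u (\<lambda>x. 1 * v x)"
  proof (rule additive_bounded_imp_linear)
    show "B u (\<lambda>x. (s + t) * v x) = B u (\<lambda>x. s * v x) + B u (\<lambda>x. t * v x)" for s t
      using B_add_right[of u "\<lambda>x. s * v x" "\<lambda>x. t * v x"] assms
      by (simp add: D_scale ring_distribs)
    show "\<bar>B u (\<lambda>x. t * v x)\<bar> \<le> Q u + Q v" if t: "0 \<le> t" "t \<le> 1" for t
    proof -
      have tv: "Q (\<lambda>x. t * v x) = t\<^sup>2 * Q v" using assms by (simp add: Q_scale)
      have "t\<^sup>2 * Q v \<le> 1 * Q v" using t by (intro mult_right_mono) (auto simp: power_le_one)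
      moreover have "0 \<le> t\<^sup>2 * Q v" by simp
      moreover have "2 * Q u + 2 * Q (\<lambda>x. t * v x)
          = Q (\<lambda>x. u x + t * v x) + Q (\<lambda>x. u x - t * v x)"
        using assms by (intro Q_parallelogram D_scale)
      moreover have "\<bar>(X - p - T) / 2\<bar> \<le> p + q"
        if "T \<le> 1 * q" "0 \<le> T" "2 * p + 2 * T = X + Y" "0 \<le> X" "0 \<le> Y" "0 \<le> p"
        for X Y T p q :: real
        using that by (simp add: abs_le_iff field_simps)
      ultimately show ?thesis
        unfolding B_def tv using enn2real_nonneg by blast
    qed
  qed
  then show ?thesis by simp
qed

lemma Q_add_scale:
  assumes "u \<in> D" "v \<in> D"
  shows "Q (\<lambda>x. u x + t * v x) = Q u + 2 * t * B u v + t\<^sup>2 * Q v"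
  using Q_add[of u "\<lambda>x. t * v x"] assms by (simp add: B_scale_right Q_scale)

lemma Q_diff:
  assumes "u \<in> D" "v \<in> D"
  shows "Q (\<lambda>x. u x - v x) = Q u - 2 * B u v + Q v"
  using Q_add_scale[OF assms, of "-1"] by simp

lemma nrm_nonneg [simp]: "0 \<le> nrm u"
  by (simp add: form_seminorm_def)

lemma nrm_sq: "(nrm u)\<^sup>2 = Q u"
  by (simp add: form_seminorm_def)

lemma nrm_add:
  assumes "u \<in> D" "v \<in> D"
  shows "nrm (\<lambda>x. u x + v x) \<le> nrm u + nrm v"
proof (rule field_le_epsilon)
  fix e :: real assume "0 < e"
  \<comment> \<open>The seminorms may vanish; the margin \<open>e / 2\<close> makes \<open>a\<close>
    and \<open>b\<close> positive, so that the Cauchy-Schwarz inequality obtained from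
    \<open>Q (b u - a v) \<ge> 0\<close> can be divided by \<open>2 * a * b\<close>.\<close>
  define a where "a = nrm u + e / 2"
  define b where "b = nrm v + e / 2"
  have ab: "0 < a" "0 < b" "nrm u \<le> a" "nrm v \<le> b"
    using \<open>0 < e\<close> by (auto simp: a_def b_def add_nonneg_pos)
  have Q: "Q u \<le> a\<^sup>2" "Q v \<le> b\<^sup>2"
    using ab by (auto simp flip: nrm_sq intro: power_mono)
  have "0 \<le> Q (\<lambda>x. b * u x + (- a) * v x)" by simp
  also have "\<dots> = b\<^sup>2 * Q u - 2 * a * b * B u v + a\<^sup>2 * Q v"
    using assms Q_add_scale[of "\<lambda>x. b * u x" v "- a"] B_scale_right[of v u b]
    by (simp add: D_scale Q_scale B_commute)
  finally have "2 * a * b * B u v \<le> b\<^sup>2 * Q u + a\<^sup>2 * Q v" by simp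
  also have "\<dots> \<le> b\<^sup>2 * a\<^sup>2 + a\<^sup>2 * b\<^sup>2"
    by (intro add_mono mult_left_mono Q) auto
  also have "\<dots> = (2 * a * b) * (a * b)" by (simp add: power2_eq_square)
  finally have "B u v \<le> a * b" using ab by simp
  then have "(nrm (\<lambda>x. u x + v x))\<^sup>2 \<le> (a + b)\<^sup>2"
    using Q by (simp add: nrm_sq power2_sum Q_add)
  then have "nrm (\<lambda>x. u x + v x) \<le> a + b"
    by (rule power2_le_imp_le) (use ab in simp)
  then show "nrm (\<lambda>x. u x + v x) \<le> nrm u + nrm v + e"
    by (simp add: a_def b_def)
qed

lemma nrm_scale: "u \<in> D \<Longrightarrow> nrm (\<lambda>x. c * u x) = \<bar>c\<bar> * nrm u"
  by (simp add: form_seminorm_def Q_scale real_sqrt_mult)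

lemma nrm_uminus: "u \<in> D \<Longrightarrow> nrm (\<lambda>x. - u x) = nrm u"
  by (simp add: form_seminorm_def Q_uminus)

lemma nrm_diff:
  assumes "u \<in> D" "v \<in> D"
  shows "nrm (\<lambda>x. u x - v x) \<le> nrm u + nrm v"
  using nrm_add[OF assms(1) D_uminus[OF assms(2)]] assms by (simp add: nrm_uminus)

lemma E_le_imp:
  assumes "v \<in> borel_measurable M" "E v \<le> E u" "u \<in> D"
  shows "v \<in> D" "Q v \<le> Q u" "nrm v \<le> nrm u"
proof -
  show "v \<in> D" using assms D_I[OF assms(1,2)] D_finite by simp
  show "Q v \<le> Q u" using assms D_finite by (intro enn2real_mono) auto
  then show "nrm v \<le> nrm u" by (simp add: form_seminorm_def)
qed

lemma E_le_iff_Q: "u \<in> D \<Longrightarrow> 0 \<le> K \<Longrightarrow> E u \<le> ennreal K \<longleftrightarrow> Q u \<le> K"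
  by (metis E_eq ennreal_le_iff)

text \<open>Here u minimizes the energy along the ray u + t v, so the derivative
  \<open>2 * B u v\<close> at t = 0 is nonnegative. It is applied to u = T (u + t v) with a map T
  that does not raise the energy.\<close>

lemma B_nonnegI:
  assumes "u \<in> D" "v \<in> D" "\<And>t. 0 < t \<Longrightarrow> E u \<le> E (\<lambda>x. u x + t * v x)"
  shows "0 \<le> B u v"
proof -
  have "0 \<le> 2 * B u v"
  proof (rule quadratic_nonneg_imp_linear_nonneg[where c = "Q v"])
    fix t :: real assume "0 < t"
    have "Q u \<le> Q (\<lambda>x. u x + t * v x)"
      using assms \<open>0 < t\<close> by (intro E_le_imp(2) assms(3) D_add D_scale D_measurable)
    then show "0 \<le> t * (2 * B u v) + t\<^sup>2 * Q v"
      using Q_add_scale[OF assms(1,2), of t] by simp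
  qed
  then show ?thesis by simp
qed

end

section \<open>Convergence in the form topology\<close>

lemma limitin_topology_generated_by:
  "limitin (topology_generated_by \<B>) f l F \<longleftrightarrow>
     l \<in> \<Union>\<B> \<and> (\<forall>S\<in>\<B>. l \<in> S \<longrightarrow> (\<forall>\<^sub>F i in F. f i \<in> S))"
proof (intro iffI conjI ballI impI)
  assume "limitin (topology_generated_by \<B>) f l F"
  then show "l \<in> \<Union>\<B>" "\<And>S. S \<in> \<B> \<Longrightarrow> l \<in> S \<Longrightarrow> \<forall>\<^sub>F i in F. f i \<in> S"
    by (auto simp: limitin_def topology_generated_by_topspace topology_generated_by_Basis)
next
  assume l: "l \<in> \<Union>\<B> \<and> (\<forall>S\<in>\<B>. l \<in> S \<longrightarrow> (\<forall>\<^sub>F i in F. f i \<in> S))"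
  have "l \<in> V \<longrightarrow> (\<forall>\<^sub>F i in F. f i \<in> V)" if "generate_topology_on \<B> V" for V
    using that
  proof induction
    case (UN K)
    then show ?case by (blast intro: eventually_mono)
  qed (use l in \<open>auto intro: eventually_conj\<close>)
  then show "limitin (topology_generated_by \<B>) f l F"
    using l by (simp add: limitin_def topology_generated_by_topspace openin_topology_generated_by_iff)
qed

section \<open>Pseudometrics of local convergence in measure\<close>

lemma loc_dist_sub: "loc_dist M U (\<lambda>x. f x - g x) (\<lambda>x. 0) = loc_dist M U f g"
  by (simp add: loc_dist_def)

lemma loc_dist_commute: "loc_dist M U f g = loc_dist M U g f"
  by (simp add: loc_dist_def abs_minus_commute)

lemma loc_dist_mono:
  assumes "U \<in> sets M" "emeasure M U < \<infinity>" "f \<in> L0 M" "g \<in> L0 M" "h \<in> L0 M" "k \<in> L0 M"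
    and "AE x in M. min \<bar>f x - g x\<bar> 1 \<le> min \<bar>h x - k x\<bar> 1"
  shows "loc_dist M U f g \<le> loc_dist M U h k"
  unfolding loc_dist_def set_lebesgue_integral_def
  by (rule integral_mono_AE)
     (use assms integrable_loc_dist[OF assms(1,2)] in \<open>auto simp: set_integrable_def indicator_def\<close>)

lemma loc_dist_mono_set:
  assumes "U \<in> sets M" "V \<in> sets M" "emeasure M V < \<infinity>" "f \<in> L0 M" "g \<in> L0 M" "U \<subseteq> V"
  shows "loc_dist M U f g \<le> loc_dist M V f g"
proof -
  have "emeasure M U < \<infinity>" using emeasure_mono[of U V M] assms by (auto intro: le_less_trans)
  then have "integrable M (\<lambda>x. indicator U x *\<^sub>R min \<bar>f x - g x\<bar> 1)"
    "integrable M (\<lambda>x. indicator V x *\<^sub>R min \<bar>f x - g x\<bar> 1)"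
    using integrable_loc_dist assms by (auto simp: set_integrable_def)
  then show ?thesis
    unfolding loc_dist_def set_lebesgue_integral_def
    by (rule integral_mono) (use assms in \<open>auto simp: indicator_def\<close>)
qed

lemma loc_dist_bounded:
  assumes "U \<in> sets M" "emeasure M U < \<infinity>" "f \<in> L0 M" "g \<in> L0 M"
    and "AE x in M. \<bar>f x - g x\<bar> \<le> e"
  shows "loc_dist M U f g \<le> e * measure M U"
proof -
  have "loc_dist M U f g \<le> (LINT x|M. e * indicator U x)"
    unfolding loc_dist_def set_lebesgue_integral_def
  proof (rule integral_mono_AE)
    show "integrable M (\<lambda>x. indicator U x *\<^sub>R min \<bar>f x - g x\<bar> 1)"
      using integrable_loc_dist[OF assms(1-4)] by (simp add: set_integrable_def)
    show "integrable M (\<lambda>x. e * indicator U x)"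
      using assms by (intro integrable_mult_right) simp
    show "AE x in M. indicator U x *\<^sub>R min \<bar>f x - g x\<bar> 1 \<le> e * indicator U x"
      using assms(5) by eventually_elim (auto simp: indicator_def)
  qed
  then show ?thesis using assms by simp
qed

lemma loc_dist_tendsto:
  assumes U: "U \<in> sets M" "emeasure M U < \<infinity>" and meas: "\<And>n. f n \<in> L0 M" "g \<in> L0 M"
    and lim: "AE x in M. (\<lambda>n::nat. f n x) \<longlonglongrightarrow> g x"
  shows "(\<lambda>n. loc_dist M U (f n) g) \<longlonglongrightarrow> 0"
proof -
  note [measurable] = U(1) meas
  have "(\<lambda>n. LINT x|M. indicator U x *\<^sub>R min \<bar>f n x - g x\<bar> 1) \<longlonglongrightarrow> (LINT x|M. 0)"
  proof (rule integral_dominated_convergence[where w = "indicator U"])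
    show "AE x in M. (\<lambda>n. indicator U x *\<^sub>R min \<bar>f n x - g x\<bar> 1) \<longlonglongrightarrow> 0"
      using lim
    proof eventually_elim
      case (elim x)
      have "(\<lambda>n. indicator U x *\<^sub>R min \<bar>f n x - g x\<bar> 1)
          \<longlonglongrightarrow> indicator U x *\<^sub>R min \<bar>g x - g x\<bar> 1"
        by (intro tendsto_intros elim)
      then show ?case by simp
    qed
  qed (use U in \<open>auto simp: indicator_def\<close>)
  then show ?thesis
    by (simp add: loc_dist_def set_lebesgue_integral_def)
qed

text \<open>Every finite-measure part of the set where f and g differ is null, and by semifiniteness
  a set of infinite measure contains a part of positive finite measure. Hence limits in local
  measure are unique almost everywhere.\<close>

lemma loc_dist_eq_0_imp_AE_eq:
  assumes "semifinite_measure M" and [measurable]: "f \<in> L0 M" "g \<in> L0 M"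
    and "\<And>U. U \<in> sets M \<Longrightarrow> emeasure M U < \<infinity> \<Longrightarrow> loc_dist M U f g = 0"
  shows "AE x in M. f x = g x"
proof -
  define A where "A = {x \<in> space M. f x \<noteq> g x}"
  have [measurable]: "A \<in> sets M" unfolding A_def by measurable
  have null: "emeasure M U = 0" if "U \<in> sets M" "emeasure M U < \<infinity>" "U \<subseteq> A" for U
  proof -
    note [measurable] = that(1)
    have "integrable M (\<lambda>x. indicator U x *\<^sub>R min \<bar>f x - g x\<bar> 1)"
      using integrable_loc_dist[of U M f g] that by (simp add: set_integrable_def)
    moreover have "(LINT x|M. indicator U x *\<^sub>R min \<bar>f x - g x\<bar> 1) = 0"
      using assms(4)[of U] that by (simp add: loc_dist_def set_lebesgue_integral_def)
    ultimately have "AE x in M. indicator U x *\<^sub>R min \<bar>f x - g x\<bar> 1 = 0"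
      by (subst (asm) integral_nonneg_eq_0_iff_AE) auto
    then have "AE x in M. x \<notin> U"
      by eventually_elim (use that(3) in \<open>auto simp: A_def indicator_def min_def split: if_splits\<close>)
    then have "U \<in> null_sets M" using that(1) by (simp add: AE_iff_null_sets)
    then show ?thesis by (rule null_setsD1)
  qed
  have "emeasure M A = 0"
  proof (cases "emeasure M A < \<infinity>")
    case True
    then show ?thesis by (intro null) auto
  next
    case False
    then have "emeasure M A = \<infinity>" by (simp add: less_top[symmetric])
    then obtain U where "U \<in> sets M" "U \<subseteq> A" "0 < emeasure M U" "emeasure M U < \<infinity>"
      using assms(1) \<open>A \<in> sets M\<close> unfolding semifinite_measure_def by blast
    then show ?thesis using null[of U] by simp
  qed
  then show ?thesis
    by (intro AE_I[of _ _ A]) (auto simp: A_def)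
qed

section \<open>Limits in the seminorm topology and in the form topology\<close>

context quadratic
begin

lemma limitin_seminorm_topology:
  "limitin (seminorm_topology M E) f l F \<longleftrightarrow>
     l \<in> D \<and> (\<forall>\<^sub>F i in F. f i \<in> D) \<and> ((\<lambda>i. nrm (\<lambda>x. f i x - l x)) \<longlongrightarrow> 0) F"
  (is "?lim \<longleftrightarrow> ?rhs")
proof
  assume ?lim
  note lim = this[unfolded seminorm_topology_def limitin_topology_generated_by]
  then have l: "l \<in> D" by auto
  have ev: "\<forall>\<^sub>F i in F. f i \<in> {g \<in> D. nrm (\<lambda>x. g x - u x) < r}"
    if "u \<in> D" "0 < r" "nrm (\<lambda>x. l x - u x) < r" for u r
    by (rule lim[THEN conjunct2, rule_format]) (use l that in \<open>simp_all, blast\<close>)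
  have nrm0: "nrm (\<lambda>x. l x - l x) = 0" by (simp add: form_seminorm_def E_zero)
  have "\<forall>\<^sub>F i in F. dist (nrm (\<lambda>x. f i x - l x)) 0 < e" if "0 < e" for e
    using ev[OF l that] that nrm0 by (auto elim: eventually_mono)
  moreover have "\<forall>\<^sub>F i in F. f i \<in> D"
    using ev[OF l, of 1] nrm0 by (auto elim: eventually_mono)
  ultimately show ?rhs using l by (simp add: tendsto_iff)
next
  assume rhs: ?rhs
  show ?lim
    unfolding seminorm_topology_def limitin_topology_generated_by
  proof (intro conjI ballI impI)
    have "nrm (\<lambda>x. l x - l x) < 1" by (simp add: form_seminorm_def E_zero)
    then show "l \<in> \<Union> {{g \<in> D. nrm (\<lambda>x. g x - f x) < r} |f r. f \<in> D \<and> 0 < r}"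
      using rhs
      by (intro UnionI[of "{g \<in> D. nrm (\<lambda>x. g x - l x) < 1}"] CollectI
          exI[of _ l] exI[of _ "1::real"] conjI refl) simp_all
    fix S assume "S \<in> {{g \<in> D. nrm (\<lambda>x. g x - f x) < r} |f r. f \<in> D \<and> 0 < r}" "l \<in> S"
    then obtain u r where S: "S = {g \<in> D. nrm (\<lambda>x. g x - u x) < r}"
      and u: "u \<in> D" and r: "nrm (\<lambda>x. l x - u x) < r" by auto
    have "\<forall>\<^sub>F i in F. nrm (\<lambda>x. f i x - l x) < r - nrm (\<lambda>x. l x - u x)"
      using rhs r by (intro order_tendstoD(2)) auto
    moreover have "\<forall>\<^sub>F i in F. f i \<in> D" using rhs by blast
    ultimately show "\<forall>\<^sub>F i in F. f i \<in> S"
    proof eventually_elim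
      case (elim i)
      have "nrm (\<lambda>x. (f i x - l x) + (l x - u x)) \<le> nrm (\<lambda>x. f i x - l x) + nrm (\<lambda>x. l x - u x)"
        by (intro nrm_add D_diff elim u) (use rhs in simp_all)
      then show ?case using elim by (simp add: S)
    qed
  qed
qed

lemma topspace_seminorm_topology: "topspace (seminorm_topology M E) = D"
proof (intro equalityI subsetI)
  fix f assume "f \<in> topspace (seminorm_topology M E)"
  then have "limitin (seminorm_topology M E) (\<lambda>_. f) f (principal {f})"
    by (simp add: limitin_const)
  then show "f \<in> D" unfolding limitin_seminorm_topology by blast
next
  fix f assume "f \<in> D"
  then have "limitin (seminorm_topology M E) (\<lambda>_. f) f (principal {f})"
    unfolding limitin_seminorm_topology by (simp add: form_seminorm_def E_zero)
  then show "f \<in> topspace (seminorm_topology M E)" by (rule limitin_topspace)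
qed

text \<open>The generating sets are the open sets of two topologies on the same carrier
  \<open>D\<close>, so a limit is a limit in both. The filter is arbitrary because completeness is
  tested on filters.\<close>

lemma limitin_form_topology:
  "limitin (form_topology M E) f l F \<longleftrightarrow>
     l \<in> D \<and> (\<forall>\<^sub>F i in F. f i \<in> D) \<and>
     (\<forall>U\<in>sets M. emeasure M U < \<infinity> \<longrightarrow> ((\<lambda>i. loc_dist M U (f i) l) \<longlongrightarrow> 0) F) \<and>
     ((\<lambda>i. nrm (\<lambda>x. f i x - l x)) \<longlongrightarrow> 0) F"
proof -
  let ?T1 = "subtopology (loc_measure_topology M) D" and ?T2 = "seminorm_topology M E"
  have "topspace ?T1 = D" "topspace ?T2 = D"
    by (auto simp: topspace_seminorm_topology D_measurable)
  then have "\<Union> ({V. openin ?T1 V} \<union> {V. openin ?T2 V}) = D"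
    by (simp add: Union_Un_distrib flip: topspace_def)
  then have "limitin (form_topology M E) f l F \<longleftrightarrow> limitin ?T1 f l F \<and> limitin ?T2 f l F"
    unfolding form_topology_def limitin_topology_generated_by
    using \<open>topspace ?T1 = D\<close> \<open>topspace ?T2 = D\<close>
    unfolding limitin_def by blast
  moreover have "\<forall>\<^sub>F i in F. f i \<in> L0 M" if "\<forall>\<^sub>F i in F. f i \<in> D"
    using that by eventually_elim (rule D_measurable)
  ultimately show ?thesis
    unfolding limitin_seminorm_topology limitin_subtopology limitin_loc_measure_topology
    by (auto simp: D_measurable simp flip: loc_dist_def)
qed

lemma topspace_form_topology: "topspace (form_topology M E) = D"
proof (intro equalityI subsetI)
  fix f assume "f \<in> topspace (form_topology M E)"
  then have "limitin (form_topology M E) (\<lambda>_. f) f (principal {f})"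
    by (simp add: limitin_const)
  then show "f \<in> D" unfolding limitin_form_topology by blast
next
  fix f assume "f \<in> D"
  then have "limitin (form_topology M E) (\<lambda>_. f) f (principal {f})"
    unfolding limitin_form_topology by (simp add: form_seminorm_def E_zero)
  then show "f \<in> topspace (form_topology M E)" by (rule limitin_topspace)
qed

end

section \<open>Lower semicontinuity\<close>

locale energy = quadratic +
  assumes semifinite: "semifinite_measure M" and energy: "energy_form M E"
begin

text \<open>This replaces lower semicontinuity as long as the latter is unknown: u is approached by
  sets rather than by given functions, which leaves the freedom to select near-minimizers in each
  set. Closure under midpoints is exactly what the parallelogram identity consumes.\<close>

lemma convex_family_E_le:
  fixes \<S> :: "('a \<Rightarrow> real) set set" and K :: ennreal
  assumes u: "u \<in> L0 M"
    and nonempty: "\<S> \<noteq> {}"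
    and sub: "\<And>S. S \<in> \<S> \<Longrightarrow> S \<subseteq> L0 M"
    and mid: "\<And>S v w. S \<in> \<S> \<Longrightarrow> v \<in> S \<Longrightarrow> w \<in> S \<Longrightarrow> (\<lambda>x. (1/2) * (v x + w x)) \<in> S"
    and directed: "\<And>S T. S \<in> \<S> \<Longrightarrow> T \<in> \<S> \<Longrightarrow> \<exists>R\<in>\<S>. R \<subseteq> S \<inter> T"
    and bound: "\<And>S. S \<in> \<S> \<Longrightarrow> \<exists>v\<in>S. E v \<le> K"
    and conv: "\<And>U r. U \<in> sets M \<Longrightarrow> emeasure M U < \<infinity> \<Longrightarrow> 0 < r \<Longrightarrow>
      \<exists>S\<in>\<S>. \<forall>v\<in>S. loc_dist M U v u < r"
  shows "E u \<le> K"
proof (cases K)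
  case top
  then show ?thesis by simp
next
  case (real k)
  \<comment> \<open>\<open>A\<close> holds the energy levels attained or undercut in every member of
    the family, so its infimum is the supremum over S of the infimum of \<open>E\<close> on S. Every
    S has elements of energy close to \<open>a\<close> from above (\<open>near\<close>), and some S
    has none of energy much below \<open>a\<close> (\<open>far\<close>).\<close>
  define A where "A = {a. 0 \<le> a \<and> (\<forall>S\<in>\<S>. \<exists>v\<in>S. E v \<le> ennreal a)}"
  define a where "a = Inf A"
  have kA: "k \<in> A" using real bound by (auto simp: A_def)
  have bdd: "bdd_below A" by (auto simp: A_def intro: bdd_belowI[of _ 0])
  have a: "0 \<le> a" "a \<le> k"
    unfolding a_def using kA bdd by (auto intro!: cInf_greatest cInf_lower simp: A_def)
  have near: "\<exists>v\<in>S. v \<in> D \<and> Q v \<le> a + \<eta>" if "S \<in> \<S>" "0 < \<eta>" for S \<eta>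
  proof -
    have "Inf A < a + \<eta>" using that by (simp add: a_def)
    then obtain b where b: "b \<in> A" "b < a + \<eta>"
      using cInf_lessD kA by blast
    then obtain v where v: "v \<in> S" "E v \<le> ennreal b" using \<open>S \<in> \<S>\<close> unfolding A_def by blast
    then have "v \<in> L0 M" using sub[OF \<open>S \<in> \<S>\<close>] by blast
    then have "v \<in> D" by (rule D_I[OF _ v(2)]) simp
    moreover have "Q v \<le> b" using v \<open>v \<in> D\<close> b by (simp add: A_def E_le_iff_Q)
    ultimately show ?thesis using v b by force
  qed
  have far: "\<exists>S\<in>\<S>. \<forall>v\<in>S. v \<in> D \<longrightarrow> a - \<eta> \<le> Q v" if "0 < \<eta>" for \<eta>
  proof (cases "0 \<le> a - \<eta>")
    case True
    have "a - \<eta> \<notin> A" using cInf_lower[OF _ bdd, of "a - \<eta>"] that by (auto simp: a_def)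
    then obtain S where S: "S \<in> \<S>" "\<And>v. v \<in> S \<Longrightarrow> \<not> E v \<le> ennreal (a - \<eta>)"
      using True by (auto simp: A_def)
    have "a - \<eta> \<le> Q v" if "v \<in> S" "v \<in> D" for v
      using S(2)[OF that(1)] E_le_iff_Q[OF that(2) True] by linarith
    then show ?thesis using S(1) by blast
  next
    case False
    then show ?thesis using nonempty enn2real_nonneg by (smt (verit) ex_in_conv)
  qed
  \<comment> \<open>The near-minimizers: none of these sets is empty, and by directedness they form
    a filter base along which S shrinks and \<eta> tends to 0.\<close>
  define P where "P S \<eta> = {v \<in> S. v \<in> D \<and> Q v \<le> a + \<eta>}" for S \<eta>
  have P_nonempty: "P S \<eta> \<noteq> {}" if "S \<in> \<S>" "0 < \<eta>" for S \<eta>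
    using near[OF that] by (auto simp: P_def)
  define F where "F = (INF p\<in>\<S> \<times> {0<..}. principal (P (fst p) (snd p)))"
  have ev: "eventually R F \<longleftrightarrow> (\<exists>S\<in>\<S>. \<exists>\<eta>>0. \<forall>v\<in>P S \<eta>. R v)" for R
    unfolding F_def
  proof (subst eventually_INF_base)
    show "\<S> \<times> {0::real<..} \<noteq> {}" using nonempty by (auto intro: exI[of _ 1])
    fix p q assume pq: "p \<in> \<S> \<times> {0::real<..}" "q \<in> \<S> \<times> {0::real<..}"
    then obtain R where "R \<in> \<S>" "R \<subseteq> fst p \<inter> fst q"
      using directed[of "fst p" "fst q"] by auto
    then show "\<exists>x\<in>\<S> \<times> {0<..}. principal (P (fst x) (snd x))
        \<le> inf (principal (P (fst p) (snd p))) (principal (P (fst q) (snd q)))"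
      using pq by (intro bexI[of _ "(R, min (snd p) (snd q))"]) (auto simp: P_def)
  qed (auto simp: eventually_principal)
  have ev_pair: "eventually R (F \<times>\<^sub>F F)"
    if "S \<in> \<S>" "0 < \<eta>" "\<And>v w. v \<in> P S \<eta> \<Longrightarrow> w \<in> P S \<eta> \<Longrightarrow> R (v, w)" for S \<eta> R
    unfolding eventually_prod_filter
    by (rule exI[of _ "\<lambda>v. v \<in> P S \<eta>"], rule exI[of _ "\<lambda>v. v \<in> P S \<eta>"]) (use that in \<open>auto simp: ev\<close>)
  obtain S0 where S0: "S0 \<in> \<S>" using nonempty by blast
  have F_bot: "F \<noteq> bot"
    using P_nonempty by (auto simp: trivial_limit_def ev)
  have F_D: "eventually (\<lambda>v. v \<in> D) F"
    using S0 by (auto simp: ev P_def intro: exI[of _ 1])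
  have limit_0: "limitin (form_topology M E) (\<lambda>p x. fst p x - snd p x) (\<lambda>x. 0) (F \<times>\<^sub>F F)"
    unfolding limitin_form_topology
  proof (intro conjI ballI impI D_zero)
    show "\<forall>\<^sub>F p in F \<times>\<^sub>F F. (\<lambda>x. fst p x - snd p x) \<in> D"
      by (rule ev_pair[OF S0 zero_less_one]) (auto simp: P_def intro: D_diff)
    show "((\<lambda>p. loc_dist M U (\<lambda>x. fst p x - snd p x) (\<lambda>x. 0)) \<longlongrightarrow> 0) (F \<times>\<^sub>F F)"
      if U: "U \<in> sets M" "emeasure M U < \<infinity>" for U
      unfolding tendsto_iff loc_dist_sub
    proof (intro allI impI)
      fix e :: real assume "0 < e"
      then obtain S where S: "S \<in> \<S>" "\<And>v. v \<in> S \<Longrightarrow> loc_dist M U v u < e / 2"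
        using conv[OF U, of "e / 2"] by auto
      show "\<forall>\<^sub>F p in F \<times>\<^sub>F F. dist (loc_dist M U (fst p) (snd p)) 0 < e"
      proof (rule ev_pair[OF S(1) zero_less_one])
        fix v w assume "v \<in> P S 1" "w \<in> P S 1"
        then have "v \<in> S" "w \<in> S" by (auto simp: P_def)
        then show "dist (loc_dist M U (fst (v, w)) (snd (v, w))) 0 < e"
          using loc_dist_triangle[OF U, of v u w] S(2)[of v] S(2)[of w] sub[OF S(1)] u
          by (simp add: loc_dist_nonneg loc_dist_commute[of M U u w] subset_eq)
      qed
    qed
    show "((\<lambda>p. nrm (\<lambda>x. fst p x - snd p x - 0)) \<longlongrightarrow> 0) (F \<times>\<^sub>F F)"
      unfolding tendsto_iff
    proof (intro allI impI)
      fix e :: real assume "0 < e"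
      \<comment> \<open>For v and w in \<open>P S \<eta>\<close> the midpoint has energy at least a
        - \<eta>, so the parallelogram identity bounds the energy of v - w by 4 (a + \<eta>) - 4 (a
        - \<eta>) = 8 \<eta>, half of \<open>e\<^sup>2\<close>.\<close>
      define \<eta> where "\<eta> = e\<^sup>2 / 16"
      have \<eta>: "0 < \<eta>" using \<open>0 < e\<close> by (simp add: \<eta>_def)
      obtain S where S: "S \<in> \<S>" "\<And>v. v \<in> S \<Longrightarrow> v \<in> D \<Longrightarrow> a - \<eta> \<le> Q v" using far[OF \<eta>] by blast
      show "\<forall>\<^sub>F p in F \<times>\<^sub>F F. dist (nrm (\<lambda>x. fst p x - snd p x - 0)) 0 < e"
      proof (rule ev_pair[OF S(1) \<eta>])
        fix v w assume "v \<in> P S \<eta>" "w \<in> P S \<eta>"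
        then have v: "v \<in> S" "v \<in> D" "Q v \<le> a + \<eta>" and w: "w \<in> S" "w \<in> D" "Q w \<le> a + \<eta>"
          by (auto simp: P_def)
        have "a - \<eta> \<le> Q (\<lambda>x. (1/2) * (v x + w x))"
          by (rule S(2)[OF mid[OF S(1) v(1) w(1)] D_scale[OF D_add[OF v(2) w(2)]]])
        also have "\<dots> = Q (\<lambda>x. v x + w x) / 4"
          using v w by (subst Q_scale) (auto intro: D_add simp: power2_eq_square)
        finally have "Q (\<lambda>x. v x - w x) \<le> 8 * \<eta>"
          using Q_parallelogram[OF v(2) w(2)] v w by linarith
        also have "\<dots> < e\<^sup>2" using \<open>0 < e\<close> by (simp add: \<eta>_def)
        finally have "(nrm (\<lambda>x. v x - w x))\<^sup>2 < e\<^sup>2" by (simp add: nrm_sq)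
        then have "nrm (\<lambda>x. v x - w x) < e" by (rule power2_less_imp_less) (use \<open>0 < e\<close> in simp)
        then show "dist (nrm (\<lambda>x. fst (v, w) x - snd (v, w) x - 0)) 0 < e" by simp
      qed
    qed
  qed
  have "cauchy_filter_in (form_topology M E) F"
    unfolding cauchy_filter_in_def topspace_form_topology
    using F_bot F_D limit_0
    by (auto simp: le_principal limitin_def case_prod_unfold)
  then obtain w where w: "limitin (form_topology M E) (\<lambda>g. g) w F"
    using energy by (auto simp: energy_form_def closed_form_def complete_tvs_def)
  note w = w[unfolded limitin_form_topology]
  then have wD: "w \<in> D" by blast
  \<comment> \<open>The filter converges to its form limit \<open>w\<close> and, by
    \<open>conv\<close>, to \<open>u\<close>; both limits hold locally in measure, so they
    agree.\<close>
  have "loc_dist M U w u = 0" if U: "U \<in> sets M" "emeasure M U < \<infinity>" for U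
  proof -
    have "loc_dist M U w u \<le> 0 + r" if "0 < r" for r
    proof -
      have "((\<lambda>v. loc_dist M U v w) \<longlongrightarrow> 0) F" using w U by blast
      then have "\<forall>\<^sub>F v in F. loc_dist M U v w < r / 2"
        by (rule order_tendstoD) (use \<open>0 < r\<close> in simp)
      moreover have "\<forall>\<^sub>F v in F. loc_dist M U v u < r / 2"
      proof -
        obtain S where "S \<in> \<S>" "\<forall>v\<in>S. loc_dist M U v u < r / 2"
          using conv[OF U, of "r / 2"] \<open>0 < r\<close> by auto
        then show ?thesis by (auto simp: ev P_def intro!: bexI[of _ S] exI[of _ 1])
      qed
      ultimately have "\<forall>\<^sub>F v in F. loc_dist M U v w < r / 2 \<and> loc_dist M U v u < r / 2 \<and> v \<in> D"
        using F_D by eventually_elim auto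
      then obtain v where "loc_dist M U v w < r / 2" "loc_dist M U v u < r / 2" "v \<in> D"
        using eventually_happens'[OF F_bot] by blast
      then show ?thesis
        using loc_dist_triangle[OF U, of w v u] wD u
        by (simp add: D_measurable loc_dist_commute[of M U w v])
    qed
    then have "loc_dist M U w u \<le> 0" by (rule field_le_epsilon)
    then show ?thesis using loc_dist_nonneg[of M U w u] by simp
  qed
  then have "AE x in M. w x = u x"
    by (intro loc_dist_eq_0_imp_AE_eq[OF semifinite] u D_measurable wD)
  then have "E u = E w" using E_cong[of w u] wD u by (simp add: D_measurable)
  have "nrm w \<le> sqrt a"
  proof (rule field_le_epsilon)
    fix e :: real assume "0 < e"
    have "((\<lambda>v. nrm (\<lambda>x. v x - w x)) \<longlongrightarrow> 0) F" using w by blast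
    then have "\<forall>\<^sub>F v in F. nrm (\<lambda>x. v x - w x) < e / 2"
      by (rule order_tendstoD) (use \<open>0 < e\<close> in simp)
    moreover have "\<forall>\<^sub>F v in F. v \<in> D \<and> Q v \<le> a + (e / 2)\<^sup>2"
      using S0 \<open>0 < e\<close> by (auto simp: ev P_def intro!: bexI[of _ S0] exI[of _ "(e/2)\<^sup>2"])
    ultimately have "\<forall>\<^sub>F v in F. nrm (\<lambda>x. v x - w x) < e / 2 \<and> v \<in> D \<and> Q v \<le> a + (e / 2)\<^sup>2"
      by eventually_elim auto
    then obtain v where v: "nrm (\<lambda>x. v x - w x) < e / 2" "v \<in> D" "Q v \<le> a + (e / 2)\<^sup>2"
      using eventually_happens'[OF F_bot] by blast
    have "0 \<le> sqrt a * e" using a \<open>0 < e\<close> by simp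
    then have "(nrm v)\<^sup>2 \<le> (sqrt a + e / 2)\<^sup>2"
      using v(3) real_sqrt_pow2[OF a(1)] unfolding nrm_sq power2_sum by linarith
    then have "nrm v \<le> sqrt a + e / 2"
      by (rule power2_le_imp_le) (use a \<open>0 < e\<close> in simp)
    moreover have "nrm w \<le> nrm v + nrm (\<lambda>x. v x - w x)"
      using nrm_diff[OF v(2) D_diff[OF v(2) wD]] by simp
    ultimately show "nrm w \<le> sqrt a + e" using v by linarith
  qed
  then have "(nrm w)\<^sup>2 \<le> (sqrt a)\<^sup>2" by (intro power_mono) auto
  then have "Q w \<le> k" using a by (simp add: nrm_sq)
  then show ?thesis
    using \<open>E u = E w\<close> wD real by (simp add: E_le_iff_Q)
qed

lemma E_clamp_01_le:
  assumes f [measurable]: "f \<in> L0 M"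
  shows "E (\<lambda>x. max 0 (min 1 (f x))) \<le> E f"
proof -
  define u where "u = (\<lambda>x. max 0 (min 1 (f x)))"
  have [measurable]: "u \<in> L0 M" by (simp add: u_def)
  define S where "S e = {v \<in> L0 M. AE x in M. \<bar>v x - u x\<bar> \<le> e}" for e
  have "E u \<le> E f"
  proof (rule convex_family_E_le[where \<S> = "S ` {0<..}"])
    fix T v w assume "T \<in> S ` {0<..}" "v \<in> T" "w \<in> T"
    then obtain e where T: "T = S e"
      and v [measurable]: "v \<in> L0 M" "w \<in> L0 M"
      and AE: "AE x in M. \<bar>v x - u x\<bar> \<le> e" "AE x in M. \<bar>w x - u x\<bar> \<le> e"
      by (auto simp: S_def)
    have "AE x in M. \<bar>1/2 * (v x + w x) - u x\<bar> \<le> e"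
      using AE by eventually_elim (auto simp: abs_le_iff field_simps)
    then show "(\<lambda>x. (1/2) * (v x + w x)) \<in> T" by (auto simp: T S_def)
  next
    fix T1 T2 assume "T1 \<in> S ` {0<..}" "T2 \<in> S ` {0<..}"
    then obtain e1 e2 where e: "0 < e1" "0 < e2" "T1 = S e1" "T2 = S e2" by auto
    have "S (min e1 e2) \<subseteq> S e1 \<inter> S e2" by (auto simp: S_def)
    then show "\<exists>R\<in>S ` {0<..}. R \<subseteq> T1 \<inter> T2" using e by auto
  next
    fix T assume "T \<in> S ` {0<..}"
    then obtain e where e: "0 < e" "T = S e" by auto
    obtain C where C: "cutoff e C" and le: "\<forall>f\<in>L0 M. E (C \<circ> f) \<le> E f"
      using energy e(1) unfolding energy_form_def markovian_form_def by blast
    have "mono C" "\<And>x. - e \<le> C x" "\<And>x. C x \<le> 1 + e" "\<And>x. 0 \<le> x \<Longrightarrow> x \<le> 1 \<Longrightarrow> C x = x"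
      using C by (auto simp: cutoff_def)
    \<comment> \<open>Outside [0, 1] monotonicity puts \<open>C y\<close> beyond the fixed value at
      the nearer endpoint, and the range of a cutoff lets it overshoot by at most
      \<open>e\<close>.\<close>
    have "\<bar>C y - max 0 (min 1 y)\<bar> \<le> e" for y
    proof -
      consider "y < 0" | "0 \<le> y" "y \<le> 1" | "1 < y" by linarith
      then show ?thesis
      proof cases
        case 1
        then show ?thesis
          using monoD[OF \<open>mono C\<close>, of y 0] \<open>- e \<le> C y\<close> \<open>\<And>x. 0 \<le> x \<Longrightarrow> x \<le> 1 \<Longrightarrow> C x = x\<close>[of 0] by simp
      next
        case 2
        then show ?thesis using \<open>\<And>x. 0 \<le> x \<Longrightarrow> x \<le> 1 \<Longrightarrow> C x = x\<close>[of y] e by simp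
      next
        case 3
        then show ?thesis
          using monoD[OF \<open>mono C\<close>, of 1 y] \<open>C y \<le> 1 + e\<close> \<open>\<And>x. 0 \<le> x \<Longrightarrow> x \<le> 1 \<Longrightarrow> C x = x\<close>[of 1] by simp
      qed
    qed
    moreover have "C \<in> borel_measurable borel" using \<open>mono C\<close> by (rule borel_measurable_mono)
    then have "C \<circ> f \<in> L0 M" using f by (rule measurable_comp[rotated])
    ultimately have "C \<circ> f \<in> T" by (auto simp: e S_def u_def)
    then show "\<exists>v\<in>T. E v \<le> E f" using le f by blast
  next
    fix U :: "'a set" and r :: real assume U: "U \<in> sets M" "emeasure M U < \<infinity>" and "0 < r"
    \<comment> \<open>A uniform error \<open>e\<close> costs at most \<open>e * measure M U\<close>
      in \<open>loc_dist\<close>; the summand 1 covers null sets U.\<close>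
    define e where "e = r / (measure M U + 1)"
    have pos: "0 < measure M U + 1" by (simp add: add_nonneg_pos)
    have e: "0 < e" using \<open>0 < r\<close> pos by (simp add: e_def)
    have "loc_dist M U v u < r" if "v \<in> S e" for v
    proof -
      have "loc_dist M U v u \<le> e * measure M U"
        using that by (intro loc_dist_bounded U) (auto simp: S_def)
      also have "\<dots> < e * (measure M U + 1)" using e by simp
      also have "\<dots> = r" using pos by (simp add: e_def)
      finally show ?thesis .
    qed
    then show "\<exists>T\<in>S ` {0<..}. \<forall>v\<in>T. loc_dist M U v u < r" using e by auto
  qed (auto simp: S_def)
  then show ?thesis by (simp add: u_def)
qed

lemma E_le_if_truncations_le:
  assumes u [measurable]: "u \<in> L0 M"
    and trunc: "\<And>n::nat. 0 < n \<Longrightarrow> E (\<lambda>x. max (- real n) (min (real n) (u x))) \<le> K"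
  shows "E u \<le> K"
proof -
  define S where "S n = {v \<in> L0 M. AE x in M. \<bar>u x\<bar> \<le> real n \<longrightarrow> v x = u x}" for n
  show ?thesis
  proof (rule convex_family_E_le[where \<S> = "S ` {0<..}"])
    fix T v w assume "T \<in> S ` {0<..}" "v \<in> T" "w \<in> T"
    then obtain n where T: "T = S n"
      and [measurable]: "v \<in> L0 M" "w \<in> L0 M"
      and AE: "AE x in M. \<bar>u x\<bar> \<le> real n \<longrightarrow> v x = u x"
        "AE x in M. \<bar>u x\<bar> \<le> real n \<longrightarrow> w x = u x"
      by (auto simp: S_def)
    have "AE x in M. \<bar>u x\<bar> \<le> real n \<longrightarrow> 1/2 * (v x + w x) = u x"
      using AE by eventually_elim auto
    then show "(\<lambda>x. (1/2) * (v x + w x)) \<in> T" by (auto simp: T S_def)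
  next
    fix T1 T2 assume "T1 \<in> S ` {0<..}" "T2 \<in> S ` {0<..}"
    then obtain n1 n2 where n: "0 < n1" "T1 = S n1" "T2 = S n2" by auto
    have "S (max n1 n2) \<subseteq> S n1 \<inter> S n2" by (auto simp: S_def elim: eventually_mono)
    then show "\<exists>R\<in>S ` {0<..}. R \<subseteq> T1 \<inter> T2" using n by (intro bexI[of _ "S (max n1 n2)"]) auto
  next
    fix T assume "T \<in> S ` {0<..}"
    then obtain n where n: "0 < n" "T = S n" by auto
    have "(\<lambda>x. max (- real n) (min (real n) (u x))) \<in> T"
      by (auto simp: n S_def)
    then show "\<exists>v\<in>T. E v \<le> K" using trunc[OF n(1)] by blast
  next
    fix U :: "'a set" and r :: real assume U: "U \<in> sets M" "emeasure M U < \<infinity>" and "0 < r"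
    \<comment> \<open>The worst member of \<open>S n\<close>, as far as \<open>loc_dist\<close> can
      see: where \<open>u\<close> exceeds n, members are unconstrained, and a difference of 1
      already reaches the cap of the integrand.\<close>
    define f where "f n x = (if \<bar>u x\<bar> \<le> real n then u x else u x + 1)" for n x
    have f [measurable]: "f n \<in> L0 M" for n unfolding f_def by measurable
    have "(\<lambda>n. loc_dist M U (f n) u) \<longlonglongrightarrow> 0"
    proof (rule loc_dist_tendsto[OF U f u], rule AE_I2, rule tendsto_eventually)
      fix x
      obtain m where "\<bar>u x\<bar> \<le> real m" using real_arch_simple by blast
      then show "\<forall>\<^sub>F n in sequentially. f n x = u x"
        by (intro eventually_sequentiallyI[of m]) (auto simp: f_def)
    qed
    then have "\<forall>\<^sub>F n in sequentially. loc_dist M U (f n) u < r"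
      using \<open>0 < r\<close> by (rule order_tendstoD)
    then have "\<forall>\<^sub>F n in sequentially. loc_dist M U (f n) u < r \<and> 0 < n"
      using eventually_gt_at_top[of 0] by eventually_elim auto
    then obtain n where n: "loc_dist M U (f n) u < r" "0 < n"
      using eventually_happens' sequentially_bot by blast
    have "loc_dist M U v u < r" if "v \<in> S n" for v
    proof -
      have "v \<in> L0 M" and AE: "AE x in M. \<bar>u x\<bar> \<le> real n \<longrightarrow> v x = u x"
        using that by (auto simp: S_def)
      have "loc_dist M U v u \<le> loc_dist M U (f n) u"
      proof (rule loc_dist_mono[OF U \<open>v \<in> L0 M\<close> u f u])
        show "AE x in M. min \<bar>v x - u x\<bar> 1 \<le> min \<bar>f n x - u x\<bar> 1"
          using AE by eventually_elim (auto simp: f_def)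
      qed
      then show ?thesis using n by simp
    qed
    then show "\<exists>T\<in>S ` {0<..}. \<forall>v\<in>T. loc_dist M U v u < r" using n by auto
  qed (auto simp: S_def)
qed

section \<open>Contractions: clamps, positive parts and truncations\<close>

lemma E_clamp_le:
  assumes f [measurable]: "f \<in> L0 M" and a: "0 < a"
  shows "E (\<lambda>x. max 0 (min a (f x))) \<le> E f"
proof -
  define g where "g x = (1 / a) * f x" for x
  have [measurable]: "g \<in> L0 M" unfolding g_def by measurable
  have "(\<lambda>x. max 0 (min a (f x))) = (\<lambda>x. a * max 0 (min 1 (g x)))"
    using a by (auto simp: g_def max_def min_def field_simps)
  then have "E (\<lambda>x. max 0 (min a (f x))) = ennreal (\<bar>a\<bar>\<^sup>2) * E (\<lambda>x. max 0 (min 1 (g x)))"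
    by (simp add: E_scale del: power2_abs)
  also have "\<dots> \<le> ennreal (\<bar>a\<bar>\<^sup>2) * E g"
    by (intro mult_left_mono E_clamp_01_le) auto
  also have "\<dots> = E (\<lambda>x. a * g x)" by (simp add: E_scale)
  also have "(\<lambda>x. a * g x) = f" using a by (auto simp: g_def)
  finally show ?thesis .
qed

text \<open>Truncating the positive part at level n gives the clamp of f to [0, n], so all
  truncations obey the bound.\<close>

lemma E_pos_le:
  assumes f [measurable]: "f \<in> L0 M"
  shows "E (\<lambda>x. max 0 (f x)) \<le> E f"
proof (rule E_le_if_truncations_le)
  fix n :: nat assume "0 < n"
  have "(\<lambda>x. max (- real n) (min (real n) (max 0 (f x)))) = (\<lambda>x. max 0 (min (real n) (f x)))"
    by (auto simp: max_def min_def)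
  then show "E (\<lambda>x. max (- real n) (min (real n) (max 0 (f x)))) \<le> E f"
    using E_clamp_le[OF f, of "real n"] \<open>0 < n\<close> by simp
qed measurable

lemma
  assumes "f \<in> D"
  shows D_pos: "(\<lambda>x. max 0 (f x)) \<in> D" and nrm_pos: "nrm (\<lambda>x. max 0 (f x)) \<le> nrm f"
proof -
  note [measurable] = D_measurable[OF assms]
  have "(\<lambda>x. max 0 (f x)) \<in> L0 M" by measurable
  note this E_pos_le[OF D_measurable[OF assms]] assms
  then show "(\<lambda>x. max 0 (f x)) \<in> D" "nrm (\<lambda>x. max 0 (f x)) \<le> nrm f"
    by (rule E_le_imp)+
qed

lemma D_clamp:
  assumes "f \<in> D" "0 < a"
  shows "(\<lambda>x. max 0 (min a (f x))) \<in> D"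
proof -
  note [measurable] = D_measurable[OF assms(1)]
  show ?thesis
    by (rule E_le_imp(1)[OF _ E_clamp_le[OF D_measurable[OF assms(1)] assms(2)] assms(1)]) measurable
qed

lemma D_excess:
  assumes "f \<in> D" "0 < a"
  shows "(\<lambda>x. max 0 (f x - a)) \<in> D"
proof -
  have "(\<lambda>x. max 0 (f x - a)) = (\<lambda>x. max 0 (f x) - max 0 (min a (f x)))"
    using assms(2) by (auto simp: max_def min_def)
  then show ?thesis using D_diff[OF D_pos[OF assms(1)] D_clamp[OF assms]] by simp
qed

text \<open>The first summand is the clamp of itself plus any positive multiple of the second one.\<close>

lemma B_clamp_excess_nonneg:
  assumes f: "f \<in> D" and a: "0 < a"
  shows "0 \<le> B (\<lambda>x. max 0 (min a (f x))) (\<lambda>x. max 0 (f x - a))"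
proof (rule B_nonnegI[OF D_clamp[OF f a] D_excess[OF f a]])
  fix t :: real assume t: "0 < t"
  note [measurable] = D_measurable[OF f]
  let ?g = "\<lambda>x. max 0 (min a (f x)) + t * max 0 (f x - a)"
  have "max 0 (min a (f x)) = max 0 (min a (?g x))" for x
    using t a by (cases "f x \<le> a") (auto simp: max_def min_def)
  then have "(\<lambda>x. max 0 (min a (f x))) = (\<lambda>x. max 0 (min a (?g x)))" by blast
  then show "E (\<lambda>x. max 0 (min a (f x))) \<le> E ?g"
    using E_clamp_le[of ?g a] a by simp
qed

text \<open>Decompose f = y + (p - r) into the excess y over a, the clamp p to [0, a] and the
  negative part r. Then p - r is the minimum of a and f, and dropping y does not raise the energy
  because \<open>B y p\<close> and \<open>B y (- r)\<close> are both nonnegative.\<close>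

lemma E_min_le:
  assumes f [measurable]: "f \<in> L0 M" and a: "0 < a"
  shows "E (\<lambda>x. min a (f x)) \<le> E f"
proof (cases "f \<in> D")
  case False
  then show ?thesis using f by (simp add: form_domain_def less_top[symmetric])
next
  case True
  define p where "p = (\<lambda>x. max 0 (min a (f x)))"
  define r where "r = (\<lambda>x. max 0 (- f x))"
  define y where "y = (\<lambda>x. max 0 (f x - a))"
  have p: "p \<in> D" and y: "y \<in> D"
    unfolding p_def y_def by (rule D_clamp[OF True a], rule D_excess[OF True a])
  have r: "r \<in> D" unfolding r_def by (rule D_pos[OF D_uminus[OF True]])
  note [measurable] = y[THEN D_measurable] r[THEN D_measurable]
  have "0 \<le> B y (\<lambda>x. - r x)"
  proof (rule B_nonnegI[OF y D_uminus[OF r]])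
    fix t :: real assume t: "0 < t"
    \<comment> \<open>\<open>y\<close> and \<open>r\<close> live on disjoint sets, so the positive
      part of y - t r is y again.\<close>
    have "y x = max 0 (y x + t * - r x)" for x
      using t a mult_pos_neg[of t "f x"] by (cases "f x < 0") (auto simp: r_def y_def max_def)
    then have "y = (\<lambda>x. max 0 (y x + t * - r x))" by blast
    then show "E y \<le> E (\<lambda>x. y x + t * - r x)"
      using E_pos_le[of "\<lambda>x. y x + t * - r x"] by simp
  qed
  moreover have "0 \<le> B p y" unfolding p_def y_def by (rule B_clamp_excess_nonneg[OF True a])
  moreover have "B y (\<lambda>x. p x + - r x) = B y p + B y (\<lambda>x. - r x)"
    by (intro B_add_right y p D_uminus r)
  moreover have "Q (\<lambda>x. y x + (p x + - r x)) = Q y + 2 * B y (\<lambda>x. p x + - r x) + Q (\<lambda>x. p x + - r x)"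
    by (rule Q_add)
  moreover have "(\<lambda>x. y x + (p x + - r x)) = f"
    and eq: "(\<lambda>x. p x + - r x) = (\<lambda>x. min a (f x))"
    using a by (auto simp: y_def p_def r_def max_def min_def)
  moreover have "0 \<le> Q y" by simp
  ultimately have "Q (\<lambda>x. min a (f x)) \<le> Q f" by (simp add: B_commute[of y p])
  moreover have "(\<lambda>x. min a (f x)) \<in> D"
    using D_diff[OF p r] eq by simp
  ultimately have "E (\<lambda>x. min a (f x)) \<le> ennreal (Q f)"
    by (subst E_le_iff_Q) auto
  then show ?thesis using E_eq[OF True] by metis
qed

lemma E_truncate_le:
  assumes f [measurable]: "f \<in> L0 M" and a: "0 < a"
  shows "E (\<lambda>x. max (- a) (min a (f x))) \<le> E f"
proof -
  have "(\<lambda>x. max (- a) (min a (f x))) = (\<lambda>x. - min a (- min a (f x)))"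
    by (auto simp: max_def min_def)
  then have "E (\<lambda>x. max (- a) (min a (f x))) = E (\<lambda>x. min a (- min a (f x)))"
    by (simp add: E_uminus)
  also have "\<dots> \<le> E (\<lambda>x. - min a (f x))" using a by (intro E_min_le) auto
  also have "\<dots> = E (\<lambda>x. min a (f x))" by (simp add: E_uminus)
  also have "\<dots> \<le> E f" using a by (intro E_min_le) auto
  finally show ?thesis .
qed

text \<open>\<open>L\<^sup>0\<close> is not locally convex, but on uniformly bounded sets \<open>loc_dist\<close> is, up to scaling, an
  \<open>L\<^sup>1\<close>-distance with convex balls. Truncation reduces lower semicontinuity to this case.\<close>

lemma E_lower_semicontinuous:
  assumes u [measurable]: "u \<in> L0 M"
    and approx: "\<And>U r. U \<in> sets M \<Longrightarrow> emeasure M U < \<infinity> \<Longrightarrow> 0 < r \<Longrightarrow>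
      \<exists>v\<in>L0 M. E v \<le> K \<and> loc_dist M U v u < r"
  shows "E u \<le> K"
proof (rule E_le_if_truncations_le[OF u])
  fix n :: nat assume "0 < n"
  \<comment> \<open>Two functions with values in [-n, n] differ by at most \<open>d\<close>. After
    division by \<open>d\<close> the cap 1 in \<open>loc_dist\<close> is inactive, which is why
    members of \<open>S p\<close> must also satisfy \<bar>v - u'\<bar> \<le> d.\<close>
  define d where "d = 2 * real n"
  have d: "1 \<le> d" using \<open>0 < n\<close> by (simp add: d_def)
  define T where "T x = max (- real n) (min (real n) x)" for x
  define u' where "u' x = T (u x)" for x
  have [measurable]: "u' \<in> L0 M" unfolding u'_def T_def by measurable
  define S where "S p = {v \<in> L0 M. (AE x in M. \<bar>v x - u' x\<bar> \<le> d) \<and>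
    loc_dist M (fst p) (\<lambda>x. v x / d) (\<lambda>x. u' x / d) < snd p}" for p
  define I where "I = {U \<in> sets M. emeasure M U < \<infinity>} \<times> {0::real<..}"
  have "E u' \<le> K"
  proof (rule convex_family_E_le[where \<S> = "S ` I"])
    fix A v w assume "A \<in> S ` I" "v \<in> A" "w \<in> A"
    then obtain U r where A: "A = S (U, r)" and U: "U \<in> sets M" "emeasure M U < \<infinity>"
      and vw [measurable]: "v \<in> L0 M" "w \<in> L0 M"
      and AE: "AE x in M. \<bar>v x - u' x\<bar> \<le> d" "AE x in M. \<bar>w x - u' x\<bar> \<le> d"
      and r: "loc_dist M U (\<lambda>x. v x / d) (\<lambda>x. u' x / d) < r"
        "loc_dist M U (\<lambda>x. w x / d) (\<lambda>x. u' x / d) < r"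
      by (auto simp: S_def I_def)
    let ?m = "\<lambda>x. (1/2) * (v x + w x)"
    let ?I = "\<lambda>v x. indicator U x *\<^sub>R min \<bar>v x / d - u' x / d\<bar> 1"
    have int: "integrable M (?I v)" if [measurable]: "v \<in> L0 M" for v
      using integrable_loc_dist[OF U, of "\<lambda>x. v x / d" "\<lambda>x. u' x / d"]
      by (simp add: set_integrable_def)
    have m: "AE x in M. \<bar>?m x - u' x\<bar> \<le> d"
      using AE by eventually_elim (auto simp: abs_le_iff field_simps)
    have "(LINT x|M. ?I ?m x) \<le> (LINT x|M. (1/2) * (?I v x + ?I w x))"
    proof (rule integral_mono_AE)
      show "AE x in M. ?I ?m x \<le> (1/2) * (?I v x + ?I w x)"
        using AE m
      proof eventually_elim
        case (elim x)
        have quot: "min \<bar>y / d - u' x / d\<bar> 1 = \<bar>y - u' x\<bar> / d" if "\<bar>y - u' x\<bar> \<le> d" for y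
          using that d by (simp add: abs_divide flip: diff_divide_distrib)
        have "?m x - u' x = (1/2) * ((v x - u' x) + (w x - u' x))" by (simp add: field_simps)
        then have "\<bar>?m x - u' x\<bar> = (1/2) * \<bar>(v x - u' x) + (w x - u' x)\<bar>"
          by (simp only: abs_mult)
        also have "\<dots> \<le> (1/2) * (\<bar>v x - u' x\<bar> + \<bar>w x - u' x\<bar>)"
          by (intro mult_left_mono abs_triangle_ineq) simp
        finally have "\<bar>?m x - u' x\<bar> \<le> (1/2) * (\<bar>v x - u' x\<bar> + \<bar>w x - u' x\<bar>)" .
        then have "\<bar>?m x - u' x\<bar> / d \<le> (1/2) * (\<bar>v x - u' x\<bar> + \<bar>w x - u' x\<bar>) / d"
          using d by (intro divide_right_mono) auto
        then show ?case
          by (simp only: quot[OF elim(1)] quot[OF elim(2)] quot[OF elim(3)])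
             (simp add: indicator_def add_divide_distrib)
      qed
    qed (intro integrable_mult_right Bochner_Integration.integrable_add int; measurable)+
    also have "\<dots> = (1/2) * ((LINT x|M. ?I v x) + (LINT x|M. ?I w x))"
      by (simp only: integral_mult_right_zero
          Bochner_Integration.integral_add[OF int[OF vw(1)] int[OF vw(2)]])
    also have "\<dots> < r" using r by (simp add: loc_dist_def set_lebesgue_integral_def)
    finally show "?m \<in> A"
      using m by (simp add: A S_def loc_dist_def set_lebesgue_integral_def)
  next
    fix A1 A2 assume "A1 \<in> S ` I" "A2 \<in> S ` I"
    then obtain U1 r1 U2 r2 where A: "A1 = S (U1, r1)" "A2 = S (U2, r2)"
      and I: "(U1, r1) \<in> I" "(U2, r2) \<in> I" by auto
    then have fin: "U1 \<union> U2 \<in> sets M" "emeasure M (U1 \<union> U2) < \<infinity>"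
      using emeasure_subadditive[of U1 M U2] by (auto simp: I_def intro: le_less_trans)
    have "S (U1 \<union> U2, min r1 r2) \<subseteq> A1 \<inter> A2"
    proof
      fix v assume "v \<in> S (U1 \<union> U2, min r1 r2)"
      then have v [measurable]: "v \<in> L0 M" and "AE x in M. \<bar>v x - u' x\<bar> \<le> d"
        and less: "loc_dist M (U1 \<union> U2) (\<lambda>x. v x / d) (\<lambda>x. u' x / d) < min r1 r2"
        by (auto simp: S_def)
      have "loc_dist M V (\<lambda>x. v x / d) (\<lambda>x. u' x / d) < min r1 r2" if "V \<in> {U1, U2}" for V
        using that I by (intro le_less_trans[OF loc_dist_mono_set less] fin) (auto simp: I_def)
      then show "v \<in> A1 \<inter> A2" using v \<open>AE x in M. \<bar>v x - u' x\<bar> \<le> d\<close> by (auto simp: A S_def)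
    qed
    moreover have "(U1 \<union> U2, min r1 r2) \<in> I" using I fin by (auto simp: I_def)
    ultimately show "\<exists>R\<in>S ` I. R \<subseteq> A1 \<inter> A2" by blast
  next
    fix A assume "A \<in> S ` I"
    then obtain U r where A: "A = S (U, r)" and U: "U \<in> sets M" "emeasure M U < \<infinity>" "0 < r"
      by (auto simp: I_def)
    obtain v where v [measurable]: "v \<in> L0 M" and v': "E v \<le> K" "loc_dist M U v u < r"
      using approx[OF U] by blast
    define w where "w x = T (v x)" for x
    have w [measurable]: "w \<in> L0 M" unfolding w_def T_def by measurable
    have "E w \<le> E v"
      using E_truncate_le[OF v, of "real n"] \<open>0 < n\<close> by (simp add: w_def[abs_def] T_def)
    moreover have "w \<in> A"
    proof -
      have "\<bar>T y\<bar> \<le> real n" for y by (auto simp: T_def)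
      then have "\<bar>w x - u' x\<bar> \<le> d" for x
        using abs_triangle_ineq4[of "w x" "u' x"] unfolding w_def u'_def d_def
        by (smt (verit, best))
      \<comment> \<open>Truncation is 1-Lipschitz and d \<ge> 1, so neither truncating nor rescaling
        increases the distance.\<close>
      moreover have "loc_dist M U (\<lambda>x. w x / d) (\<lambda>x. u' x / d) \<le> loc_dist M U v u"
      proof (rule loc_dist_mono[OF U(1,2)])
        have "\<bar>w x / d - u' x / d\<bar> \<le> \<bar>v x - u x\<bar>" for x
        proof -
          have "\<bar>w x - u' x\<bar> / d \<le> \<bar>w x - u' x\<bar> / 1" using d by (intro divide_left_mono) auto
          also have "\<dots> \<le> \<bar>v x - u x\<bar>" by (auto simp: w_def u'_def T_def max_def min_def abs_if)
          finally show ?thesis using d by (simp add: abs_divide flip: diff_divide_distrib)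
        qed
        then show "AE x in M. min \<bar>w x / d - u' x / d\<bar> 1 \<le> min \<bar>v x - u x\<bar> 1"
          by (intro AE_I2 min.mono) auto
      qed measurable
      ultimately show ?thesis using v'(2) by (auto simp: A S_def)
    qed
    ultimately show "\<exists>v\<in>A. E v \<le> K" using v'(1) by (meson order_trans)
  next
    fix U :: "'a set" and r :: real assume U: "U \<in> sets M" "emeasure M U < \<infinity>" and "0 < r"
    \<comment> \<open>Undoing the rescaling costs the factor \<open>d\<close>, hence the radius
      \<open>r / d\<close>.\<close>
    have "loc_dist M U v u' < r" if "v \<in> S (U, r / d)" for v
    proof -
      have v [measurable]: "v \<in> L0 M"
        and less: "loc_dist M U (\<lambda>x. v x / d) (\<lambda>x. u' x / d) < r / d"
        using that by (auto simp: S_def)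
      have "loc_dist M U v u' \<le> (LINT x|M. d * (indicator U x *\<^sub>R min \<bar>v x / d - u' x / d\<bar> 1))"
        unfolding loc_dist_def set_lebesgue_integral_def
      proof (rule integral_mono)
        show "integrable M (\<lambda>x. indicator U x *\<^sub>R min \<bar>v x - u' x\<bar> 1)"
          using integrable_loc_dist[OF U, of v u'] by (simp add: set_integrable_def)
        show "integrable M (\<lambda>x. d * (indicator U x *\<^sub>R min \<bar>v x / d - u' x / d\<bar> 1))"
          using integrable_loc_dist[OF U, of "\<lambda>x. v x / d" "\<lambda>x. u' x / d"]
          by (intro integrable_mult_right) (simp add: set_integrable_def)
        show "indicator U x *\<^sub>R min \<bar>v x - u' x\<bar> 1
            \<le> d * (indicator U x *\<^sub>R min \<bar>v x / d - u' x / d\<bar> 1)" for x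
        proof -
          have "d * min \<bar>v x / d - u' x / d\<bar> 1 = min \<bar>v x - u' x\<bar> d"
            using d by (auto simp: min_def field_simps simp flip: diff_divide_distrib)
          then show ?thesis using d by (auto simp: indicator_def)
        qed
      qed
      also have "\<dots> = d * loc_dist M U (\<lambda>x. v x / d) (\<lambda>x. u' x / d)"
        by (simp add: loc_dist_def set_lebesgue_integral_def)
      also have "\<dots> < r" using less d by (simp add: field_simps)
      finally show ?thesis .
    qed
    moreover have "(U, r / d) \<in> I" using U \<open>0 < r\<close> d by (simp add: I_def)
    ultimately show "\<exists>A\<in>S ` I. \<forall>v\<in>A. loc_dist M U v u' < r" by blast
  next
    have "({}, 1) \<in> I" by (simp add: I_def)
    then show "S ` I \<noteq> {}" by blast
  qed (auto simp: S_def)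
  then show "E (\<lambda>x. max (- real n) (min (real n) (u x))) \<le> K"
    by (simp add: u'_def[abs_def] T_def)
qed

lemma E_le_if_pointwise_limit:
  assumes "u \<in> L0 M" "\<And>n. f n \<in> L0 M" "AE x in M. (\<lambda>n::nat. f n x) \<longlonglongrightarrow> u x"
    and "\<And>n. E (f n) \<le> K"
  shows "E u \<le> K"
proof (rule E_lower_semicontinuous[OF assms(1)])
  fix U :: "'a set" and r :: real assume U: "U \<in> sets M" "emeasure M U < \<infinity>" and "0 < r"
  have "\<forall>\<^sub>F n in sequentially. loc_dist M U (f n) u < r"
    using loc_dist_tendsto[OF U assms(2,1,3)] \<open>0 < r\<close> by (rule order_tendstoD)
  then obtain n where "loc_dist M U (f n) u < r"
    using eventually_happens' sequentially_bot by blast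
  then show "\<exists>v\<in>L0 M. E v \<le> K \<and> loc_dist M U v u < r" using assms by blast
qed

section \<open>Lattice operations and products\<close>

text \<open>The positive and the negative part each have seminorm at most that of f. The crude
  factor 2 is harmless, since these bounds only serve to keep energies bounded.\<close>

lemma
  assumes "f \<in> D"
  shows D_abs: "(\<lambda>x. \<bar>f x\<bar>) \<in> D" and nrm_abs: "nrm (\<lambda>x. \<bar>f x\<bar>) \<le> 2 * nrm f"
proof -
  have eq: "(\<lambda>x. \<bar>f x\<bar>) = (\<lambda>x. max 0 (f x) + max 0 (- f x))"
    by (auto simp: max_def)
  note D = D_pos[OF assms] D_pos[OF D_uminus[OF assms]]
  show "(\<lambda>x. \<bar>f x\<bar>) \<in> D" unfolding eq by (rule D_add[OF D])
  show "nrm (\<lambda>x. \<bar>f x\<bar>) \<le> 2 * nrm f"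
    unfolding eq
    using nrm_add[OF D] nrm_pos[OF assms] nrm_pos[OF D_uminus[OF assms]] nrm_uminus[OF assms]
    by linarith
qed

lemma
  assumes "f \<in> D" "g \<in> D"
  shows D_min: "(\<lambda>x. min (f x) (g x)) \<in> D"
    and nrm_min: "nrm (\<lambda>x. min (f x) (g x)) \<le> 2 * nrm f + nrm g"
proof -
  have eq: "(\<lambda>x. min (f x) (g x)) = (\<lambda>x. f x - max 0 (f x - g x))"
    by (auto simp: max_def min_def)
  note D = assms(1) D_pos[OF D_diff[OF assms]]
  show "(\<lambda>x. min (f x) (g x)) \<in> D" unfolding eq by (rule D_diff[OF D])
  show "nrm (\<lambda>x. min (f x) (g x)) \<le> 2 * nrm f + nrm g"
    unfolding eq
    using nrm_diff[OF D] nrm_pos[OF D_diff[OF assms]] nrm_diff[OF assms] by linarith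
qed

lemma D_max:
  assumes "f \<in> D" "g \<in> D"
  shows "(\<lambda>x. max (f x) (g x)) \<in> D"
proof -
  have "(\<lambda>x. max (f x) (g x)) = (\<lambda>x. - min (- f x) (- g x))" by (auto simp: max_def min_def)
  then show ?thesis using D_uminus[OF D_min[OF D_uminus[OF assms(1)] D_uminus[OF assms(2)]]] by simp
qed

lemma D_truncate:
  assumes "f \<in> D" "0 < a"
  shows "(\<lambda>x. max (- a) (min a (f x))) \<in> D"
proof -
  note [measurable] = D_measurable[OF assms(1)]
  show ?thesis
    by (rule E_le_imp(1)[OF _ E_truncate_le[OF D_measurable[OF assms(1)] assms(2)] assms(1)]) measurable
qed

text \<open>Partial sums of \<open>x (1 - x) = (\<Sum>k\<ge>1. T\<^sup>k x / 4\<^sup>k)\<close> for the tent map \<open>T\<close>. Composing with \<open>T\<close> at most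
  doubles the energy seminorm, so the partial sums are uniformly bounded in energy.\<close>

primrec tent_sum :: "nat \<Rightarrow> real \<Rightarrow> real" where
  "tent_sum 0 x = 0"
| "tent_sum (Suc n) x = ((1 - \<bar>2 * x - 1\<bar>) + tent_sum n (1 - \<bar>2 * x - 1\<bar>)) / 4"

text \<open>With y the tent map at x, the parabola satisfies x (1 - x) = (y + y (1 - y)) / 4, which
  is the recursion of \<open>tent_sum\<close>; so each step divides the error by 4.\<close>

lemma tent_sum_approx:
  "0 \<le> x \<Longrightarrow> x \<le> 1 \<Longrightarrow> \<bar>tent_sum n x - x * (1 - x)\<bar> \<le> (1/4) ^ n"
proof (induction n arbitrary: x)
  case 0
  have "0 \<le> x * (1 - x)" "x * (1 - x) \<le> 1" using 0 by (auto intro!: mult_le_one)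
  then show ?case by simp
next
  case (Suc n)
  define y where "y = 1 - \<bar>2 * x - 1\<bar>"
  have y: "0 \<le> y" "y \<le> 1" using Suc.prems by (auto simp: y_def abs_if)
  have tent_Suc: "tent_sum (Suc n) x = (y + tent_sum n y) / 4" by (simp add: y_def)
  have parabola: "x * (1 - x) = (y + y * (1 - y)) / 4"
    by (simp add: y_def abs_if algebra_simps)
  have "tent_sum (Suc n) x - x * (1 - x) = (1/4) * (tent_sum n y - y * (1 - y))"
    by (simp only: tent_Suc parabola) (simp add: field_simps)
  then have "\<bar>tent_sum (Suc n) x - x * (1 - x)\<bar> = (1/4) * \<bar>tent_sum n y - y * (1 - y)\<bar>"
    by (simp only: abs_mult)
  also have "\<dots> \<le> (1/4) * (1/4) ^ n" by (intro mult_left_mono Suc.IH y) simp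
  finally show ?case by simp
qed

text \<open>Split f = p + y at height 1/2. The tent map gives 2 (p - y), and since
  \<open>B p y\<close> is nonnegative, reversing the sign of y does not raise the energy of p +
  y.\<close>

lemma tent_in_D:
  assumes f: "f \<in> D" and "\<And>x. 0 \<le> f x"
  shows "(\<lambda>x. 1 - \<bar>2 * f x - 1\<bar>) \<in> D" "nrm (\<lambda>x. 1 - \<bar>2 * f x - 1\<bar>) \<le> 2 * nrm f"
proof -
  define p where "p = (\<lambda>x. max 0 (min (1/2) (f x)))"
  define y where "y = (\<lambda>x. max 0 (f x - 1/2))"
  have p: "p \<in> D" and y: "y \<in> D"
    unfolding p_def y_def by (rule D_clamp[OF f], simp, rule D_excess[OF f], simp)
  have eq: "(\<lambda>x. 1 - \<bar>2 * f x - 1\<bar>) = (\<lambda>x. 2 * (p x - y x))"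
  proof
    fix x show "1 - \<bar>2 * f x - 1\<bar> = 2 * (p x - y x)"
      using assms(2)[of x] by (auto simp: p_def y_def max_def min_def abs_if)
  qed
  have f_eq: "(\<lambda>x. p x + y x) = f"
  proof
    fix x show "p x + y x = f x" using assms(2)[of x] by (auto simp: p_def y_def max_def min_def)
  qed
  show "(\<lambda>x. 1 - \<bar>2 * f x - 1\<bar>) \<in> D" unfolding eq by (intro D_scale D_diff p y)
  have "0 \<le> B p y" unfolding p_def y_def by (rule B_clamp_excess_nonneg[OF f]) simp
  then have "Q (\<lambda>x. p x - y x) \<le> Q f"
    using Q_diff[OF p y] Q_add[of p y] f_eq by simp
  then have "nrm (\<lambda>x. p x - y x) \<le> nrm f" by (simp add: form_seminorm_def)
  then show "nrm (\<lambda>x. 1 - \<bar>2 * f x - 1\<bar>) \<le> 2 * nrm f"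
    unfolding eq using nrm_scale[OF D_diff[OF p y], of 2] by simp
qed

text \<open>The weight 1/4 pays for two doublings: both summands have seminorm at most
  \<open>nrm g\<close>, which is at most \<open>2 * nrm f\<close>.\<close>

lemma tent_sum_in_D:
  "f \<in> D \<Longrightarrow> (\<And>x. 0 \<le> f x) \<Longrightarrow> (\<And>x. f x \<le> 1) \<Longrightarrow>
    (\<lambda>x. tent_sum n (f x)) \<in> D \<and> nrm (\<lambda>x. tent_sum n (f x)) \<le> nrm f"
proof (induction n arbitrary: f)
  case 0
  then show ?case by (simp add: D_zero form_seminorm_def E_zero)
next
  case (Suc n)
  define g where "g = (\<lambda>x. 1 - \<bar>2 * f x - 1\<bar>)"
  have g: "g \<in> D" "nrm g \<le> 2 * nrm f" unfolding g_def by (rule tent_in_D[OF Suc.prems(1,2)])+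
  have "0 \<le> g x" "g x \<le> 1" for x
    using Suc.prems(2,3)[of x] by (auto simp: g_def abs_if)
  then have IH: "(\<lambda>x. tent_sum n (g x)) \<in> D" "nrm (\<lambda>x. tent_sum n (g x)) \<le> nrm g"
    using Suc.IH[OF g(1)] by auto
  have eq: "(\<lambda>x. tent_sum (Suc n) (f x)) = (\<lambda>x. (1/4) * (g x + tent_sum n (g x)))"
    by (simp add: g_def)
  have "nrm (\<lambda>x. (1/4) * (g x + tent_sum n (g x))) \<le> nrm f"
    using nrm_scale[OF D_add[OF g(1) IH(1)], of "1/4"] nrm_add[OF g(1) IH(1)] IH(2) g(2)
    by simp
  then show ?case
    unfolding eq using D_scale[OF D_add[OF g(1) IH(1)]] by blast
qed

text \<open>Lower semicontinuity along the tent sums puts f (1 - f) into \<open>D\<close>, and the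
  square is f - f (1 - f).\<close>

lemma D_square_01:
  assumes f: "f \<in> D" "\<And>x. 0 \<le> f x" "\<And>x. f x \<le> 1"
  shows "(\<lambda>x. f x * f x) \<in> D"
proof -
  note [measurable] = D_measurable[OF f(1)]
  note tent = tent_sum_in_D[OF f]
  have "E (\<lambda>x. f x * (1 - f x)) \<le> ennreal (Q f)"
  proof (rule E_le_if_pointwise_limit)
    show "(\<lambda>x. tent_sum n (f x)) \<in> L0 M" for n using tent by (blast intro: D_measurable)
    show "AE x in M. (\<lambda>n. tent_sum n (f x)) \<longlonglongrightarrow> f x * (1 - f x)"
    proof (rule AE_I2, rule LIM_zero_cancel, rule Lim_null_comparison)
      fix x
      show "\<forall>\<^sub>F n in sequentially. norm (tent_sum n (f x) - f x * (1 - f x)) \<le> (1/4) ^ n"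
        using tent_sum_approx[OF f(2,3)] by simp
    qed (simp add: LIMSEQ_power_zero)
    show "E (\<lambda>x. tent_sum n (f x)) \<le> ennreal (Q f)" for n
      using tent[of n] by (auto simp: form_seminorm_def E_le_iff_Q)
  qed measurable
  then have "(\<lambda>x. f x * (1 - f x)) \<in> D" by (intro D_I) auto
  then have "(\<lambda>x. f x - f x * (1 - f x)) \<in> D" by (rule D_diff[OF f(1)])
  then show ?thesis by (simp add: algebra_simps)
qed

text \<open>The positive and negative parts divided by c take values in [0, 1], and their product is
  0, so their squares add up to the square of f / c.\<close>

lemma D_square:
  assumes f: "f \<in> D" and c: "0 < c" "\<And>x. \<bar>f x\<bar> \<le> c"
  shows "(\<lambda>x. f x * f x) \<in> D"
proof -
  have pos: "(\<lambda>x. max 0 (g x / c) * max 0 (g x / c)) \<in> D" if "g \<in> D" "\<And>x. \<bar>g x\<bar> \<le> c" for g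
  proof (rule D_square_01)
    have "(\<lambda>x. max 0 ((1 / c) * g x)) \<in> D" by (intro D_pos D_scale that)
    then show "(\<lambda>x. max 0 (g x / c)) \<in> D" by simp
    show "max 0 (g x / c) \<le> 1" for x using that(2)[of x] c by (auto simp: field_simps)
  qed simp
  have "(\<lambda>x. c\<^sup>2 * (max 0 (f x / c) * max 0 (f x / c) + max 0 (- f x / c) * max 0 (- f x / c))) \<in> D"
    by (intro D_scale D_add pos f D_uminus) (use c in auto)
  also have "(\<lambda>x. c\<^sup>2 * (max 0 (f x / c) * max 0 (f x / c) + max 0 (- f x / c) * max 0 (- f x / c)))
      = (\<lambda>x. f x * f x)"
    using c(1) by (auto simp: max_def field_simps power2_eq_square)
  finally show ?thesis .
qed

lemma D_mult:
  assumes f: "f \<in> D" "f \<in> Linf M" and g: "g \<in> D" "g \<in> Linf M"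
  shows "(\<lambda>x. f x * g x) \<in> D"
proof -
  note [measurable] = f(1)[THEN D_measurable] g(1)[THEN D_measurable]
  obtain c1 c2 where bd: "AE x in M. \<bar>f x\<bar> \<le> c1" "AE x in M. \<bar>g x\<bar> \<le> c2"
    using f(2) g(2) by (auto simp: Linf_def)
  \<comment> \<open>\<open>Linf\<close> gives bounds almost everywhere, while
    \<open>D_square\<close> wants them at every point; so polarization is applied to the truncated
    representatives \<open>F\<close> and \<open>G\<close>.\<close>
  define c where "c = max 1 (max c1 c2)"
  define F where "F = (\<lambda>x. max (- c) (min c (f x)))"
  define G where "G = (\<lambda>x. max (- c) (min c (g x)))"
  have c: "0 < c" by (simp add: c_def)
  have FG: "F \<in> D" "G \<in> D" unfolding F_def G_def by (intro D_truncate f g c)+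
  have FG_le: "\<bar>F x\<bar> \<le> c" "\<bar>G x\<bar> \<le> c" for x
    using c by (auto simp: F_def G_def)
  have FG_D: "(\<lambda>x. (1/4) * ((F x + G x) * (F x + G x) - (F x - G x) * (F x - G x))) \<in> D"
  proof (intro D_scale D_diff)
    have le: "\<bar>F x + G x\<bar> \<le> 2 * c" "\<bar>F x - G x\<bar> \<le> 2 * c" for x
      using FG_le[of x] by linarith+
    show "(\<lambda>x. (F x + G x) * (F x + G x)) \<in> D" "(\<lambda>x. (F x - G x) * (F x - G x)) \<in> D"
      using c by (auto intro!: D_square[OF D_add[OF FG] _ le(1)] D_square[OF D_diff[OF FG] _ le(2)])
  qed
  have AE: "AE x in M. (1/4) * ((F x + G x) * (F x + G x) - (F x - G x) * (F x - G x)) = f x * g x"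
    using bd
  proof eventually_elim
    case (elim x)
    then have "F x = f x" "G x = g x" by (auto simp: F_def G_def c_def)
    then show ?case by (simp add: algebra_simps)
  qed
  show ?thesis by (rule D_cong[OF FG_D _ AE]) measurable
qed

section \<open>Strong convergence\<close>

text \<open>Lower semicontinuity as a liminf inequality: otherwise energies at most c would recur
  arbitrarily late, and those members alone approximate u, forcing
  \<open>Q u \<le> c\<close>.\<close>

lemma eventually_Q_greater:
  assumes "u \<in> D" "\<And>n. f n \<in> D" "AE x in M. (\<lambda>n::nat. f n x) \<longlonglongrightarrow> u x" "c < Q u"
  shows "\<forall>\<^sub>F n in sequentially. c < Q (f n)"
proof (rule ccontr)
  assume "\<not> ?thesis"
  then have freq: "\<exists>\<^sub>F n in sequentially. Q (f n) \<le> c" by (simp add: frequently_def not_le)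
  then obtain n0 where "Q (f n0) \<le> c" by (auto dest: frequently_ex)
  then have c: "0 \<le> c" using enn2real_nonneg order_trans by blast
  have "E u \<le> ennreal c"
  proof (rule E_lower_semicontinuous)
    fix U :: "'a set" and r :: real assume U: "U \<in> sets M" "emeasure M U < \<infinity>" and "0 < r"
    have "(\<lambda>n. loc_dist M U (f n) u) \<longlonglongrightarrow> 0"
      by (rule loc_dist_tendsto[OF U]) (use assms in \<open>auto intro: D_measurable\<close>)
    then have "\<forall>\<^sub>F n in sequentially. loc_dist M U (f n) u < r"
      using \<open>0 < r\<close> by (rule order_tendstoD)
    then have "\<exists>\<^sub>F n in sequentially. Q (f n) \<le> c \<and> loc_dist M U (f n) u < r"
      by (intro frequently_rev_mp[OF freq]) (auto elim: eventually_mono)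
    then obtain n where "Q (f n) \<le> c" "loc_dist M U (f n) u < r" by (auto dest: frequently_ex)
    then show "\<exists>v\<in>L0 M. E v \<le> ennreal c \<and> loc_dist M U v u < r"
      using D_measurable[OF assms(2)] E_le_iff_Q[OF assms(2) c] by blast
  qed (use assms in \<open>auto intro: D_measurable\<close>)
  then show False using assms c by (simp add: E_le_iff_Q)
qed

text \<open>A Radon-Riesz argument: write \<open>Q (f n - u)\<close> as 2 \<open>Q (f n)\<close> + 2
  \<open>Q u\<close> - \<open>Q (f n + u)\<close>. The bounds \<open>K n\<close> control the first
  term, and lower semicontinuity at 2 u keeps the last one near 4 \<open>Q u\<close>. The sequence
  \<open>K\<close> leaves room for a vanishing surplus of energy.\<close>

lemma limitin_form_topologyI:
  assumes u: "u \<in> D" and f: "\<And>n. f n \<in> D" and lim: "AE x in M. (\<lambda>n::nat. f n x) \<longlonglongrightarrow> u x"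
    and le: "\<And>n. nrm (f n) \<le> K n" and K: "K \<longlonglongrightarrow> nrm u"
  shows "limitin (form_topology M E) f u sequentially"
  unfolding limitin_form_topology
proof (intro conjI ballI impI u)
  show "\<forall>\<^sub>F n in sequentially. f n \<in> D" using f by simp
  show "(\<lambda>n. loc_dist M U (f n) u) \<longlonglongrightarrow> 0" if U: "U \<in> sets M" "emeasure M U < \<infinity>" for U
    by (rule loc_dist_tendsto[OF U]) (use u f lim in \<open>auto intro: D_measurable\<close>)
  show "(\<lambda>n. nrm (\<lambda>x. f n x - u x)) \<longlonglongrightarrow> 0"
    unfolding tendsto_iff
  proof (intro allI impI)
    fix e :: real assume "0 < e"
    have "Q (\<lambda>x. u x + u x) = 4 * Q u"
      using Q_scale[OF u, of 2] by simp
    \<comment> \<open>The margins \<open>e\<^sup>2 / 2\<close> here and \<open>e\<^sup>2 / 4\<close>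
      below, the latter counted twice in the parallelogram identity, add up to
      \<open>e\<^sup>2\<close>.\<close>
    then have "4 * Q u - e\<^sup>2 / 2 < Q (\<lambda>x. u x + u x)" using \<open>0 < e\<close> by simp
    then have ev1: "\<forall>\<^sub>F n in sequentially. 4 * Q u - e\<^sup>2 / 2 < Q (\<lambda>x. f n x + u x)"
    proof (rule eventually_Q_greater[OF D_add[OF u u] D_add[OF f u], rotated])
      show "AE x in M. (\<lambda>n. f n x + u x) \<longlonglongrightarrow> u x + u x"
        using lim by eventually_elim (intro tendsto_add tendsto_const)
    qed
    have "(\<lambda>n. (K n)\<^sup>2) \<longlonglongrightarrow> (nrm u)\<^sup>2" by (intro tendsto_power K)
    then have ev2: "\<forall>\<^sub>F n in sequentially. (K n)\<^sup>2 < Q u + e\<^sup>2 / 4"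
      using \<open>0 < e\<close> by (intro order_tendstoD(2)) (auto simp: nrm_sq)
    show "\<forall>\<^sub>F n in sequentially. dist (nrm (\<lambda>x. f n x - u x)) 0 < e"
      using ev1 ev2
    proof eventually_elim
      case (elim n)
      have "Q (f n) \<le> (K n)\<^sup>2"
        using power_mono[OF le nrm_nonneg, of n 2] by (simp add: nrm_sq)
      then have "Q (\<lambda>x. f n x - u x) < e\<^sup>2"
        using Q_parallelogram[OF f[of n] u] elim by linarith
      then have "nrm (\<lambda>x. f n x - u x) < e"
        using \<open>0 < e\<close> by (intro power2_less_imp_less[of _ e]) (auto simp: nrm_sq)
      then show ?case by simp
    qed
  qed
qed

end

section \<open>Nests\<close>

context quadratic
begin

lemma openin_form_ball:
  assumes f: "f \<in> D" and U: "U \<in> sets M" "emeasure M U < \<infinity>" and "0 < r" "0 < e"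
  shows "openin (form_topology M E) {v \<in> D. loc_dist M U v f < r \<and> nrm (\<lambda>x. v x - f x) < e}"
proof -
  have "openin (loc_measure_topology M) {v \<in> L0 M. loc_dist M U v f < r}"
    unfolding loc_measure_topology_def
    by (rule topology_generated_by_Basis) (use U f \<open>0 < r\<close> D_measurable in blast)
  then have "openin (subtopology (loc_measure_topology M) D) (D \<inter> {v \<in> L0 M. loc_dist M U v f < r})"
    by (rule openin_subtopology_Int2)
  then have 1: "openin (form_topology M E) (D \<inter> {v \<in> L0 M. loc_dist M U v f < r})"
    unfolding form_topology_def by (intro topology_generated_by_Basis) simp
  have "openin (seminorm_topology M E) {v \<in> D. nrm (\<lambda>x. v x - f x) < e}"
    unfolding seminorm_topology_def
    by (rule topology_generated_by_Basis) (use f \<open>0 < e\<close> in blast)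
  then have 2: "openin (form_topology M E) {v \<in> D. nrm (\<lambda>x. v x - f x) < e}"
    unfolding form_topology_def by (intro topology_generated_by_Basis) simp
  have "{v \<in> D. loc_dist M U v f < r \<and> nrm (\<lambda>x. v x - f x) < e} =
    D \<inter> {v \<in> L0 M. loc_dist M U v f < r} \<inter> {v \<in> D. nrm (\<lambda>x. v x - f x) < e}"
    using D_measurable by blast
  then show ?thesis using openin_Int[OF 1 2] by simp
qed

lemma limitin_form_topology_diff:
  assumes "limitin (form_topology M E) f u F" "limitin (form_topology M E) g v F"
  shows "limitin (form_topology M E) (\<lambda>i x. f i x - g i x) (\<lambda>x. u x - v x) F"
proof -
  note f = assms(1)[unfolded limitin_form_topology]
    and g = assms(2)[unfolded limitin_form_topology]
  then have uv: "u \<in> D" "v \<in> D" by auto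
  have ev: "\<forall>\<^sub>F i in F. f i \<in> D \<and> g i \<in> D" using f g by (auto intro: eventually_conj)
  show ?thesis
    unfolding limitin_form_topology
  proof (intro conjI ballI impI)
    show "(\<lambda>x. u x - v x) \<in> D" by (rule D_diff[OF uv])
    show "\<forall>\<^sub>F i in F. (\<lambda>x. f i x - g i x) \<in> D"
      using ev by eventually_elim (auto intro: D_diff)
    show "((\<lambda>i. loc_dist M U (\<lambda>x. f i x - g i x) (\<lambda>x. u x - v x)) \<longlongrightarrow> 0) F"
      if U: "U \<in> sets M" "emeasure M U < \<infinity>" for U
    proof (rule Lim_null_comparison)
      show "\<forall>\<^sub>F i in F. norm (loc_dist M U (\<lambda>x. f i x - g i x) (\<lambda>x. u x - v x))
          \<le> loc_dist M U (f i) u + loc_dist M U (g i) v"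
        using ev
      proof eventually_elim
        case (elim i)
        note [measurable] = uv[THEN D_measurable] elim[THEN conjunct1, THEN D_measurable]
          elim[THEN conjunct2, THEN D_measurable]
        have "loc_dist M U (\<lambda>x. f i x - g i x) (\<lambda>x. u x - v x)
            \<le> loc_dist M U (\<lambda>x. f i x - g i x) (\<lambda>x. u x - g i x)
              + loc_dist M U (\<lambda>x. u x - g i x) (\<lambda>x. u x - v x)"
          by (rule loc_dist_triangle[OF U]) measurable
        also have "\<dots> = loc_dist M U (f i) u + loc_dist M U (g i) v"
          by (simp add: loc_dist_def abs_minus_commute)
        finally show ?case by (simp add: loc_dist_nonneg)
      qed
      show "((\<lambda>i. loc_dist M U (f i) u + loc_dist M U (g i) v) \<longlongrightarrow> 0) F"
        using f g U by (auto intro!: tendsto_add_zero)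
    qed
    show "((\<lambda>i. nrm (\<lambda>x. f i x - g i x - (u x - v x))) \<longlongrightarrow> 0) F"
    proof (rule Lim_null_comparison)
      show "\<forall>\<^sub>F i in F. norm (nrm (\<lambda>x. f i x - g i x - (u x - v x)))
          \<le> nrm (\<lambda>x. f i x - u x) + nrm (\<lambda>x. g i x - v x)"
        using ev
      proof eventually_elim
        case (elim i)
        have "(\<lambda>x. f i x - g i x - (u x - v x)) = (\<lambda>x. (f i x - u x) - (g i x - v x))"
          by (auto simp: algebra_simps)
        then show ?case
          using nrm_diff[of "\<lambda>x. f i x - u x" "\<lambda>x. g i x - v x"] elim uv by (simp add: D_diff)
      qed
      show "((\<lambda>i. nrm (\<lambda>x. f i x - u x) + nrm (\<lambda>x. g i x - v x)) \<longlongrightarrow> 0) F"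
        using f g by (intro tendsto_add_zero) blast+
    qed
  qed
qed

lemma in_nest_domainI:
  assumes "f \<in> D" "N \<in> \<N>" "\<And>x. x \<in> space M \<Longrightarrow> x \<notin> N \<Longrightarrow> f x = 0"
  shows "f \<in> nest_domain M E \<N>"
  using assms by (auto simp: nest_domain_def indicator_def intro!: bexI[of _ N])

lemma nest_domain_subspace:
  assumes "\<N> \<noteq> {}"
    and directed: "\<And>N1 N2. N1 \<in> \<N> \<Longrightarrow> N2 \<in> \<N> \<Longrightarrow> \<exists>N\<in>\<N>. N1 \<union> N2 \<subseteq> N"
  shows "linear_subspace (nest_domain M E \<N>)"
  unfolding linear_subspace_def
proof (intro conjI ballI allI)
  show "(\<lambda>x. 0) \<in> nest_domain M E \<N>"
    using assms(1) D_zero by (auto simp: nest_domain_def)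
next
  fix f g assume "f \<in> nest_domain M E \<N>" "g \<in> nest_domain M E \<N>"
  then obtain N1 N2 where fg: "f \<in> D" "g \<in> D" and N: "N1 \<in> \<N>" "N2 \<in> \<N>"
    and AE: "AE x in M. f x * indicator (space M - N1) x = 0"
      "AE x in M. g x * indicator (space M - N2) x = 0"
    unfolding nest_domain_def by blast
  obtain N where "N \<in> \<N>" "N1 \<union> N2 \<subseteq> N" using directed[OF N] by blast
  moreover from AE have "AE x in M. (f x + g x) * indicator (space M - N) x = 0"
    by eventually_elim (use \<open>N1 \<union> N2 \<subseteq> N\<close> in \<open>auto simp: indicator_def split: if_splits\<close>)
  ultimately show "(\<lambda>x. f x + g x) \<in> nest_domain M E \<N>"
    using D_add[OF fg] unfolding nest_domain_def by blast
next
  fix c f assume "f \<in> nest_domain M E \<N>"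
  then obtain N where f: "f \<in> D" and N: "N \<in> \<N>"
    and AE: "AE x in M. f x * indicator (space M - N) x = 0"
    unfolding nest_domain_def by blast
  from AE have "AE x in M. c * f x * indicator (space M - N) x = 0"
    by eventually_elim auto
  then show "(\<lambda>x. c * f x) \<in> nest_domain M E \<N>"
    using D_scale[OF f] N unfolding nest_domain_def by blast
qed

end

context energy
begin

text \<open>Directedness makes the functions supported in members of the nest a vector space;
  density then reduces to nonnegative functions by subtracting approximations of the positive and
  the negative part.\<close>

lemma form_nestI:
  assumes sets: "\<N> \<subseteq> sets M" and "\<N> \<noteq> {}"
    and directed: "\<And>N1 N2. N1 \<in> \<N> \<Longrightarrow> N2 \<in> \<N> \<Longrightarrow> \<exists>N\<in>\<N>. N1 \<union> N2 \<subseteq> N"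
    and approx: "\<And>h. h \<in> D \<Longrightarrow> (\<And>x. 0 \<le> h x) \<Longrightarrow>
      \<exists>f. (\<forall>n. f n \<in> nest_domain M E \<N>) \<and> limitin (form_topology M E) f h sequentially"
  shows "form_nest M E \<N>"
  unfolding form_nest_def
proof (intro conjI sets)
  show sub: "linear_subspace (nest_domain M E \<N>)"
    by (rule nest_domain_subspace[OF assms(2) directed])
  have "h \<in> form_topology M E closure_of nest_domain M E \<N>" if h: "h \<in> D" for h
  proof -
    obtain f g where f: "\<And>n. f n \<in> nest_domain M E \<N>"
        "limitin (form_topology M E) f (\<lambda>x. max 0 (h x)) sequentially"
      and g: "\<And>n. g n \<in> nest_domain M E \<N>"
        "limitin (form_topology M E) g (\<lambda>x. max 0 (- h x)) sequentially"
      using approx[OF D_pos[OF h]] approx[OF D_pos[OF D_uminus[OF h]]] by auto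
    have eq: "(\<lambda>x. max 0 (h x) - max 0 (- h x)) = h" by (auto simp: max_def)
    have add: "(\<lambda>x. v x + w x) \<in> nest_domain M E \<N>"
      if "v \<in> nest_domain M E \<N>" "w \<in> nest_domain M E \<N>" for v w
      using sub that by (simp add: linear_subspace_def)
    have scale: "(\<lambda>x. c * v x) \<in> nest_domain M E \<N>" if "v \<in> nest_domain M E \<N>" for c v
      using sub that by (simp add: linear_subspace_def)
    have mem: "(\<lambda>x. f n x - g n x) \<in> nest_domain M E \<N>" for n
      using add[OF f(1) scale[OF g(1)], of n "- 1" n] by simp
    show ?thesis
      unfolding in_closure_of topspace_form_topology
    proof (intro conjI h allI impI)
      fix T assume "h \<in> T \<and> openin (form_topology M E) T"
      then have "\<forall>\<^sub>F n in sequentially. (\<lambda>x. f n x - g n x) \<in> T"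
        using limitin_form_topology_diff[OF f(2) g(2)] unfolding eq limitin_def by blast
      then obtain n where "(\<lambda>x. f n x - g n x) \<in> T"
        using eventually_happens' sequentially_bot by blast
      then show "\<exists>y. y \<in> nest_domain M E \<N> \<and> y \<in> T" using mem by blast
    qed
  qed
  then show "form_topology M E closure_of nest_domain M E \<N> = D"
    using closure_of_subset_topspace[of "form_topology M E" "nest_domain M E \<N>"]
    by (auto simp: topspace_form_topology)
qed

lemma nrm_excess:
  assumes h: "h \<in> D" "\<And>x. 0 \<le> h x" and a: "0 < a"
  shows "nrm (\<lambda>x. max 0 (h x - a)) \<le> nrm h"
proof -
  have eq: "(\<lambda>x. max 0 (min a (h x)) + max 0 (h x - a)) = h"
  proof
    fix x show "max 0 (min a (h x)) + max 0 (h x - a) = h x"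
      using h(2)[of x] a by (auto simp: max_def min_def)
  qed
  have "0 \<le> Q (\<lambda>x. max 0 (min a (h x)))" by simp
  then have "Q (\<lambda>x. max 0 (h x - a)) \<le> Q h"
    using Q_add[of "\<lambda>x. max 0 (min a (h x))" "\<lambda>x. max 0 (h x - a)"]
      B_clamp_excess_nonneg[OF h(1) a] unfolding eq by linarith
  then show ?thesis by (simp add: form_seminorm_def)
qed

text \<open>Superlevel sets {u > 1} of nonnegative u in \<open>D\<close> work: the excess of h over
  1/(n+1) is supported in {(n+1) h > 1} and converges strongly to h. The lemma keeps the condition
  on all special nests from being vacuous.\<close>

lemma special_nest_exists: "\<exists>\<N>. special_nest M E \<N>"
proof
  define N where "N u = {x \<in> space M. 1 < u x}" for u :: "'a \<Rightarrow> real"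
  define C where "C = {u \<in> D. \<forall>x. 0 \<le> u x}"
  have N_sets: "N u \<in> sets M" if "u \<in> C" for u
  proof -
    have [measurable]: "u \<in> L0 M" using that D_measurable by (auto simp: C_def)
    show ?thesis unfolding N_def by measurable
  qed
  have C_scale: "(\<lambda>x. c * u x) \<in> C" if "u \<in> C" "0 \<le> c" for u c
    using that by (auto simp: C_def intro: D_scale)
  have "form_nest M E (N ` C)"
  proof (rule form_nestI)
    show "N ` C \<subseteq> sets M" using N_sets by blast
    show "N ` C \<noteq> {}" using D_zero by (auto simp: C_def)
    fix N1 N2 assume "N1 \<in> N ` C" "N2 \<in> N ` C"
    then obtain u v where uv: "u \<in> C" "v \<in> C" "N1 = N u" "N2 = N v" by blast
    have "(\<lambda>x. u x + v x) \<in> C" using uv by (auto simp: C_def intro: D_add)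
    moreover have "1 < u x + v x" if "1 < u x \<or> 1 < v x" for x
    proof -
      have "0 \<le> u x" "0 \<le> v x" using uv by (auto simp: C_def)
      then show ?thesis using that by linarith
    qed
    then have "N1 \<union> N2 \<subseteq> N (\<lambda>x. u x + v x)" by (auto simp: uv N_def)
    ultimately show "\<exists>N'\<in>N ` C. N1 \<union> N2 \<subseteq> N'" by blast
  next
    fix h assume h: "h \<in> D" "\<And>x. 0 \<le> h x"
    define f where "f n x = max 0 (h x - inverse (real (Suc n)))" for n x
    have "f n \<in> D" for n unfolding f_def by (rule D_excess[OF h(1)]) simp
    have "f n \<in> nest_domain M E (N ` C)" for n
    proof (rule in_nest_domainI[OF \<open>f n \<in> D\<close>])
      show "N (\<lambda>x. real (Suc n) * h x) \<in> N ` C"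
        using h by (intro imageI C_scale) (auto simp: C_def)
      show "f n x = 0" if "x \<in> space M" "x \<notin> N (\<lambda>x. real (Suc n) * h x)" for x
        using that by (simp add: N_def f_def max_def field_simps)
    qed
    moreover have "limitin (form_topology M E) f h sequentially"
    proof (rule limitin_form_topologyI[OF h(1) \<open>\<And>n. f n \<in> D\<close>])
      show "AE x in M. (\<lambda>n. f n x) \<longlonglongrightarrow> h x"
      proof (rule AE_I2)
        fix x
        have "(\<lambda>n. f n x) \<longlonglongrightarrow> max 0 (h x - 0)"
          unfolding f_def by (intro tendsto_intros LIMSEQ_inverse_real_of_nat)
        then show "(\<lambda>n. f n x) \<longlonglongrightarrow> h x" using h(2)[of x] by simp
      qed
      show "nrm (f n) \<le> nrm h" for n unfolding f_def by (rule nrm_excess[OF h]) simp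
    qed simp
    ultimately show "\<exists>f. (\<forall>n. f n \<in> nest_domain M E (N ` C)) \<and>
        limitin (form_topology M E) f h sequentially" by blast
  qed
  moreover have "\<exists>g\<in>nest_domain M E (N ` C). AE x in M. g x \<ge> indicator (N u) x"
    if u: "u \<in> C" for u
  proof
    have "u \<in> D" using u by (simp add: C_def)
    \<comment> \<open>Cutting at 1/2 and doubling gives a function that is at least 1 on {u > 1} and
      vanishes off {2 u > 1}, again a member of the nest.\<close>
    show "(\<lambda>x. 2 * max 0 (u x - 1/2)) \<in> nest_domain M E (N ` C)"
    proof (rule in_nest_domainI)
      show "(\<lambda>x. 2 * max 0 (u x - 1/2)) \<in> D"
        by (intro D_scale D_excess[OF \<open>u \<in> D\<close>]) simp
      show "N (\<lambda>x. 2 * u x) \<in> N ` C" by (intro imageI C_scale u) simp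
    qed (simp add: N_def max_def)
    show "AE x in M. 2 * max 0 (u x - 1/2) \<ge> indicator (N u) x"
      by (rule AE_I2) (auto simp: N_def indicator_def max_def)
  qed
  ultimately show "special_nest M E (N ` C)" by (auto simp: special_nest_def)
qed

end

section \<open>Extensions\<close>

lemma order_ideal_inD:
  "order_ideal_in M A B \<Longrightarrow> f \<in> A \<Longrightarrow> g \<in> B \<Longrightarrow> AE x in M. \<bar>g x\<bar> \<le> \<bar>f x\<bar> \<Longrightarrow> g \<in> A"
  by (auto simp: order_ideal_in_def)

locale energy_extension =
  E: energy M E + E': energy M E' for M :: "'a measure" and E E' +
  assumes extension: "form_extension M E E'"
begin

lemma extension_domain: "f \<in> form_domain M E \<Longrightarrow> f \<in> form_domain M E'"
  using extension by (auto simp: form_extension_def)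

lemma extension_eq: "f \<in> form_domain M E \<Longrightarrow> E' f = E f"
  using extension by (auto simp: form_extension_def)

lemma extension_seminorm: "f \<in> form_domain M E \<Longrightarrow> form_seminorm E' f = form_seminorm E f"
  by (simp add: form_seminorm_def extension_eq)

text \<open>The product lies in the large domain by \<open>D_mult\<close>, and a bound b on g makes
  it dominated by b f, which lies in the small one.\<close>

lemma order_ideal_imp_algebraic_ideal:
  assumes "order_ideal_in M (form_domain M E) (form_domain M E')"
  shows "algebraic_ideal_in (form_domain M E \<inter> Linf M) (form_domain M E' \<inter> Linf M)"
  unfolding algebraic_ideal_in_def
proof (intro ballI)
  fix f g assume f: "f \<in> form_domain M E \<inter> Linf M" and g: "g \<in> form_domain M E' \<inter> Linf M"
  then have D': "(\<lambda>x. f x * g x) \<in> form_domain M E'"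
    by (intro E'.D_mult) (auto intro: extension_domain)
  obtain a b where bd: "AE x in M. \<bar>f x\<bar> \<le> a" "AE x in M. \<bar>g x\<bar> \<le> b"
    using f g by (auto simp: Linf_def)
  have "(\<lambda>x. b * f x) \<in> form_domain M E" using f by (intro E.D_scale) auto
  moreover from bd(2) have "AE x in M. \<bar>f x * g x\<bar> \<le> \<bar>b * f x\<bar>"
  proof eventually_elim
    case (elim x)
    then have "\<bar>g x\<bar> * \<bar>f x\<bar> \<le> \<bar>b\<bar> * \<bar>f x\<bar>" by (intro mult_right_mono) auto
    then show ?case by (simp add: abs_mult mult.commute)
  qed
  ultimately have "(\<lambda>x. f x * g x) \<in> form_domain M E"
    by (intro order_ideal_inD[OF assms _ D'])
  moreover from bd have "AE x in M. \<bar>f x * g x\<bar> \<le> a * b"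
    by eventually_elim (auto simp: abs_mult intro!: mult_mono)
  ultimately show "(\<lambda>x. f x * g x) \<in> form_domain M E \<inter> Linf M"
    by (auto simp: Linf_def intro: E.D_measurable)
qed

text \<open>Clamping the function g \<ge> 1 on N that a special nest supplies gives a bounded h
  equal to 1 on N, so h f localizes f.\<close>

lemma algebraic_ideal_imp_local:
  assumes ideal: "algebraic_ideal_in (form_domain M E \<inter> Linf M) (form_domain M E' \<inter> Linf M)"
    and nest: "special_nest M E \<N>"
  shows "form_domain M E' \<inter> Linf M \<subseteq> local_domain_nest M E \<N>"
proof
  fix f assume f: "f \<in> form_domain M E' \<inter> Linf M"
  show "f \<in> local_domain_nest M E \<N>"
    unfolding local_domain_nest_def
  proof (intro CollectI conjI ballI)
    show "f \<in> L0 M" using f by (auto intro: E'.D_measurable)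
    fix N assume "N \<in> \<N>"
    then obtain g where g: "g \<in> form_domain M E" and AE: "AE x in M. g x \<ge> indicator N x"
      using nest unfolding special_nest_def nest_domain_def by blast
    define h where "h = (\<lambda>x. max 0 (min 1 (g x)))"
    have "h \<in> form_domain M E" unfolding h_def by (rule E.D_clamp[OF g]) simp
    moreover have "h \<in> Linf M"
      using E.D_measurable[OF \<open>h \<in> form_domain M E\<close>]
      by (auto simp: Linf_def h_def intro!: exI[of _ 1])
    ultimately have "(\<lambda>x. h x * f x) \<in> form_domain M E"
      using ideal f unfolding algebraic_ideal_in_def by blast
    moreover from AE have "AE x in M. f x * indicator N x = h x * f x * indicator N x"
      by eventually_elim (auto simp: h_def indicator_def)
    ultimately show "\<exists>h\<in>form_domain M E. AE x in M. f x * indicator N x = h x * indicator N x"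
      by (intro bexI[of _ "\<lambda>x. h x * f x"])
  qed
qed

text \<open>The nest consists of the sets where \<open>\<bar>f\<bar>\<close> is dominated by an element of the small domain;
  \<open>(h - \<bar>f\<bar>/n)\<^sup>+\<close> is supported there, is dominated by \<open>h\<close>, and converges strongly to \<open>h\<close>.\<close>

lemma order_ideal_imp_local:
  assumes ideal: "order_ideal_in M (form_domain M E) (form_domain M E')"
  shows "form_domain M E' \<subseteq> local_domain M E"
proof
  fix f assume f: "f \<in> form_domain M E'"
  note [measurable] = E'.D_measurable[OF f]
  define N where "N u = {x \<in> space M. \<bar>f x\<bar> \<le> u x}" for u
  define C where "C = {u \<in> form_domain M E. \<forall>x. 0 \<le> u x}"
  have N_sets: "N u \<in> sets M" if "u \<in> C" for u
  proof -
    have [measurable]: "u \<in> L0 M" using that E.D_measurable by (auto simp: C_def)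
    show ?thesis unfolding N_def by measurable
  qed
  have "form_nest M E (N ` C)"
  proof (rule E.form_nestI)
    show "N ` C \<subseteq> sets M" using N_sets by blast
    show "N ` C \<noteq> {}" using E.D_zero by (auto simp: C_def)
    fix N1 N2 assume "N1 \<in> N ` C" "N2 \<in> N ` C"
    then obtain u v where uv: "u \<in> C" "v \<in> C" "N1 = N u" "N2 = N v" by blast
    have "(\<lambda>x. u x + v x) \<in> C" using uv by (auto simp: C_def intro: E.D_add)
    moreover have "\<bar>f x\<bar> \<le> u x + v x" if "\<bar>f x\<bar> \<le> u x \<or> \<bar>f x\<bar> \<le> v x" for x
    proof -
      have "0 \<le> u x" "0 \<le> v x" using uv by (auto simp: C_def)
      then show ?thesis using that by linarith
    qed
    then have "N1 \<union> N2 \<subseteq> N (\<lambda>x. u x + v x)" by (auto simp: uv N_def)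
    ultimately show "\<exists>N'\<in>N ` C. N1 \<union> N2 \<subseteq> N'" by blast
  next
    fix h assume h: "h \<in> form_domain M E" "\<And>x. 0 \<le> h x"
    define k where "k n x = h x - inverse (real (Suc n)) * \<bar>f x\<bar>" for n x
    define g where "g n x = max 0 (k n x)" for n x
    have absf: "(\<lambda>x. inverse (real (Suc n)) * \<bar>f x\<bar>) \<in> form_domain M E'" for n
      by (intro E'.D_scale E'.D_abs f)
    have k: "k n \<in> form_domain M E'" for n
      unfolding k_def by (rule E'.D_diff[OF extension_domain[OF h(1)] absf])
    have "g n \<in> form_domain M E'" for n unfolding g_def by (rule E'.D_pos[OF k])
    moreover have "\<bar>g n x\<bar> \<le> \<bar>h x\<bar>" for n x using h(2)[of x] by (simp add: g_def k_def)
    ultimately have g: "g n \<in> form_domain M E" for n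
      by (intro order_ideal_inD[OF ideal h(1)]) auto
    have "g n \<in> nest_domain M E (N ` C)" for n
    proof (rule E.in_nest_domainI[OF g])
      show "N (\<lambda>x. real (Suc n) * h x) \<in> N ` C"
        using h E.D_scale[OF h(1), of "real (Suc n)"] by (intro imageI) (simp add: C_def)
      show "g n x = 0" if "x \<in> space M" "x \<notin> N (\<lambda>x. real (Suc n) * h x)" for x
        using that by (simp add: N_def g_def k_def max_def field_simps)
    qed
    moreover have "limitin (form_topology M E) g h sequentially"
    proof (rule E.limitin_form_topologyI[OF h(1) g])
      show "AE x in M. (\<lambda>n. g n x) \<longlonglongrightarrow> h x"
      proof (rule AE_I2)
        fix x
        have "(\<lambda>n. g n x) \<longlonglongrightarrow> max 0 (h x - 0 * \<bar>f x\<bar>)"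
          unfolding g_def k_def by (intro tendsto_intros LIMSEQ_inverse_real_of_nat)
        then show "(\<lambda>n. g n x) \<longlonglongrightarrow> h x" using h(2)[of x] by simp
      qed
      \<comment> \<open>The estimate passes through \<open>E'\<close>, since \<bar>f\<bar> is known
        to lie only in the large domain; its contribution vanishes as n grows.\<close>
      show "form_seminorm E (g n) \<le> form_seminorm E h
          + inverse (real (Suc n)) * form_seminorm E' (\<lambda>x. \<bar>f x\<bar>)" for n
      proof -
        have "form_seminorm E (g n) = form_seminorm E' (g n)" by (simp add: extension_seminorm g)
        also have "\<dots> \<le> form_seminorm E' (k n)" unfolding g_def by (rule E'.nrm_pos[OF k])
        also have "\<dots> \<le> form_seminorm E' h + form_seminorm E' (\<lambda>x. inverse (real (Suc n)) * \<bar>f x\<bar>)"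
          unfolding k_def by (rule E'.nrm_diff[OF extension_domain[OF h(1)] absf])
        finally show ?thesis
          using E'.nrm_scale[OF E'.D_abs[OF f], of "inverse (real (Suc n))"] h(1)
          by (simp add: extension_seminorm)
      qed
      have "(\<lambda>n. form_seminorm E h + inverse (real (Suc n)) * form_seminorm E' (\<lambda>x. \<bar>f x\<bar>))
          \<longlonglongrightarrow> form_seminorm E h + 0 * form_seminorm E' (\<lambda>x. \<bar>f x\<bar>)"
        by (intro tendsto_intros LIMSEQ_inverse_real_of_nat)
      then show "(\<lambda>n. form_seminorm E h + inverse (real (Suc n)) * form_seminorm E' (\<lambda>x. \<bar>f x\<bar>))
          \<longlonglongrightarrow> form_seminorm E h" by simp
    qed
    ultimately show "\<exists>f. (\<forall>n. f n \<in> nest_domain M E (N ` C)) \<and>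
        limitin (form_topology M E) f h sequentially" by blast
  qed
  moreover have "\<exists>h\<in>form_domain M E. AE x in M. f x * indicator (N u) x = h x * indicator (N u) x"
    if "u \<in> C" for u
  proof
    have u: "u \<in> form_domain M E" "\<And>x. 0 \<le> u x" using that by (auto simp: C_def)
    \<comment> \<open>Cutting f off between -u and u changes nothing on \<open>N u\<close> and is
      dominated by u, so the order ideal property applies.\<close>
    have "(\<lambda>x. max (- u x) (min (f x) (u x))) \<in> form_domain M E'"
      by (intro E'.D_max E'.D_min E'.D_uminus f extension_domain u)
    moreover have "\<bar>max (- u x) (min (f x) (u x))\<bar> \<le> \<bar>u x\<bar>" for x using u(2)[of x] by auto
    ultimately show "(\<lambda>x. max (- u x) (min (f x) (u x))) \<in> form_domain M E"
      by (intro order_ideal_inD[OF ideal u(1)]) auto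
    show "AE x in M. f x * indicator (N u) x = max (- u x) (min (f x) (u x)) * indicator (N u) x"
      by (rule AE_I2) (auto simp: N_def indicator_def)
  qed
  then have "f \<in> local_domain_nest M E (N ` C)"
    by (auto simp: local_domain_nest_def E'.D_measurable[OF f])
  ultimately show "f \<in> local_domain M E" by (auto simp: local_domain_def)
qed

text \<open>Approximate \<open>f\<close> in the form topology by \<open>f'\<close> supported in a set of the nest. There \<open>g\<close> is
  locally in the small domain, hence so is \<open>g \<and> \<bar>f'\<bar>\<close>, whose energy is controlled by that of
  \<open>g\<close> and \<open>f\<close>; conclude by lower semicontinuity.\<close>

lemma dominated_local_in_domain:
  assumes nest: "form_nest M E \<N>" and local: "g \<in> local_domain_nest M E \<N>"
    and g: "g \<in> form_domain M E'" "\<And>x. 0 \<le> g x"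
    and f: "f \<in> form_domain M E" and le: "AE x in M. g x \<le> \<bar>f x\<bar>"
  shows "g \<in> form_domain M E"
proof -
  \<comment> \<open>The factors come from \<open>nrm_min\<close> and \<open>nrm_abs\<close>, and
    \<open>form_seminorm E f + 1\<close> bounds the seminorm of every f' in the unit seminorm ball
    around f. So \<open>K\<close> does not depend on U and r.\<close>
  define K where "K = 2 * form_seminorm E' g + 2 * (form_seminorm E f + 1)"
  note [measurable] = E.D_measurable[OF f] E'.D_measurable[OF g(1)]
  have "E g \<le> ennreal (K\<^sup>2)"
  proof (rule E.E_lower_semicontinuous)
    fix U :: "'a set" and r :: real assume U: "U \<in> sets M" "emeasure M U < \<infinity>" "0 < r"
    define V where
      "V = {v \<in> form_domain M E. loc_dist M U v f < r \<and> form_seminorm E (\<lambda>x. v x - f x) < 1}"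
    have "f \<in> form_topology M E closure_of nest_domain M E \<N>"
      using nest f by (simp add: form_nest_def)
    moreover have "f \<in> V" using f U by (simp add: V_def form_seminorm_def E.E_zero)
    moreover have "openin (form_topology M E) V"
      unfolding V_def by (rule E.openin_form_ball[OF f U zero_less_one])
    ultimately obtain f' where f': "f' \<in> nest_domain M E \<N>" and "f' \<in> V"
      unfolding in_closure_of by blast
    then have f'_near: "loc_dist M U f' f < r" "form_seminorm E (\<lambda>x. f' x - f x) < 1"
      by (auto simp: V_def)
    from f' obtain N where D: "f' \<in> form_domain M E" and "N \<in> \<N>"
      and zero: "AE x in M. f' x * indicator (space M - N) x = 0"
      unfolding nest_domain_def by blast
    note [measurable] = E.D_measurable[OF D]
    obtain h where h: "h \<in> form_domain M E"
      and eq: "AE x in M. g x * indicator N x = h x * indicator N x"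
      using local \<open>N \<in> \<N>\<close> unfolding local_domain_nest_def by blast
    define w where "w = (\<lambda>x. min (g x) \<bar>f' x\<bar>)"
    have [measurable]: "w \<in> L0 M" unfolding w_def by measurable
    have "(\<lambda>x. min \<bar>h x\<bar> \<bar>f' x\<bar>) \<in> form_domain M E" by (intro E.D_min E.D_abs h D)
    \<comment> \<open>On N the functions g and h agree and g \<ge> 0; off N both minima are 0
      because f' vanishes there.\<close>
    moreover from zero eq AE_space have "AE x in M. min \<bar>h x\<bar> \<bar>f' x\<bar> = w x"
    proof eventually_elim
      case (elim x)
      then show ?case using g(2)[of x] by (cases "x \<in> N") (auto simp: w_def)
    qed
    ultimately have w: "w \<in> form_domain M E" by (intro E.D_cong[of _ w]) auto
    have "form_seminorm E w = form_seminorm E' w" by (simp add: extension_seminorm w)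
    also have "\<dots> \<le> 2 * form_seminorm E' g + form_seminorm E' (\<lambda>x. \<bar>f' x\<bar>)"
      unfolding w_def by (intro E'.nrm_min g E'.D_abs extension_domain D)
    also have "form_seminorm E' (\<lambda>x. \<bar>f' x\<bar>) \<le> 2 * form_seminorm E f'"
      using E'.nrm_abs[OF extension_domain[OF D]] D by (simp add: extension_seminorm)
    also have "form_seminorm E f' \<le> form_seminorm E f + 1"
      using E.nrm_add[OF f E.D_diff[OF D f]] f'_near(2) by simp
    finally have "form_seminorm E w \<le> K" by (simp add: K_def)
    then have "(form_seminorm E w)\<^sup>2 \<le> K\<^sup>2" by (intro power_mono) auto
    then have "E w \<le> ennreal (K\<^sup>2)" using w by (simp add: E.nrm_sq E.E_le_iff_Q)
    moreover have "loc_dist M U w g \<le> loc_dist M U f' f"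
    proof (rule loc_dist_mono[OF U(1,2)])
      show "AE x in M. min \<bar>w x - g x\<bar> 1 \<le> min \<bar>f' x - f x\<bar> 1"
        using le
      proof eventually_elim
        case (elim x)
        \<comment> \<open>The difference is the excess of g over \<bar>f'\<bar>, which g \<le>
          \<bar>f\<bar> bounds by the positive part of \<bar>f\<bar> - \<bar>f'\<bar>.\<close>
        then have "\<bar>w x - g x\<bar> \<le> \<bar>f' x - f x\<bar>" by (auto simp: w_def min_def)
        then show ?case by (rule min.mono) simp
      qed
    qed measurable
    ultimately show "\<exists>v\<in>L0 M. E v \<le> ennreal (K\<^sup>2) \<and> loc_dist M U v g < r"
      using f'_near(1) by (intro bexI[of _ w]) auto
  qed measurable
  then show ?thesis by (intro E.D_I) auto
qed

lemma order_ideal_if_pos_parts: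
  assumes "\<And>f g. f \<in> form_domain M E \<Longrightarrow> g \<in> form_domain M E' \<Longrightarrow>
    AE x in M. \<bar>g x\<bar> \<le> \<bar>f x\<bar> \<Longrightarrow> (\<lambda>x. max 0 (g x)) \<in> form_domain M E"
  shows "order_ideal_in M (form_domain M E) (form_domain M E')"
  unfolding order_ideal_in_def
proof (intro ballI impI)
  fix f g assume f: "f \<in> form_domain M E" and g: "g \<in> form_domain M E'"
    and le: "AE x in M. \<bar>g x\<bar> \<le> \<bar>f x\<bar>"
  have "(\<lambda>x. max 0 (g x)) \<in> form_domain M E" by (rule assms[OF f g le])
  moreover have "(\<lambda>x. max 0 (- g x)) \<in> form_domain M E"
    by (rule assms[OF f E'.D_uminus[OF g]]) (use le in simp)
  ultimately have "(\<lambda>x. max 0 (g x) - max 0 (- g x)) \<in> form_domain M E" by (rule E.D_diff)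
  also have "(\<lambda>x. max 0 (g x) - max 0 (- g x)) = g" by (auto simp: max_def)
  finally show "g \<in> form_domain M E" .
qed

lemma local_imp_order_ideal:
  assumes "form_domain M E' \<subseteq> local_domain M E"
  shows "order_ideal_in M (form_domain M E) (form_domain M E')"
proof (rule order_ideal_if_pos_parts)
  fix f g assume f: "f \<in> form_domain M E" and g: "g \<in> form_domain M E'"
    and le: "AE x in M. \<bar>g x\<bar> \<le> \<bar>f x\<bar>"
  have pos: "(\<lambda>x. max 0 (g x)) \<in> form_domain M E'" by (rule E'.D_pos[OF g])
  then obtain \<N> where \<N>: "form_nest M E \<N>" "(\<lambda>x. max 0 (g x)) \<in> local_domain_nest M E \<N>"
    using assms by (auto simp: local_domain_def)
  from le have "AE x in M. max 0 (g x) \<le> \<bar>f x\<bar>" by eventually_elim auto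
  then show "(\<lambda>x. max 0 (g x)) \<in> form_domain M E"
    by (intro dominated_local_in_domain[OF \<N> pos _ f]) auto
qed

text \<open>The hypothesis reaches bounded functions only, so g is clamped to [0, n+1]. The clamps
  lie in the small domain, where both forms agree, so their energies are at most
  \<open>E' g\<close>; lower semicontinuity of \<open>E\<close> handles the limit.\<close>

lemma special_nest_imp_order_ideal:
  assumes nest: "special_nest M E \<N>"
    and local: "form_domain M E' \<inter> Linf M \<subseteq> local_domain_nest M E \<N>"
  shows "order_ideal_in M (form_domain M E) (form_domain M E')"
proof (rule order_ideal_if_pos_parts)
  fix f g assume f: "f \<in> form_domain M E" and g: "g \<in> form_domain M E'"
    and le: "AE x in M. \<bar>g x\<bar> \<le> \<bar>f x\<bar>"
  note [measurable] = E'.D_measurable[OF g]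
  define t where "t n x = max 0 (min (real (Suc n)) (g x))" for n x
  have t': "t n \<in> form_domain M E'" for n unfolding t_def by (rule E'.D_clamp[OF g]) simp
  have t: "t n \<in> form_domain M E" for n
  proof (rule dominated_local_in_domain[OF _ _ t' _ f])
    show "form_nest M E \<N>" using nest by (simp add: special_nest_def)
    have "t n \<in> Linf M"
      using E'.D_measurable[OF t'] by (auto simp: Linf_def t_def intro!: exI[of _ "real (Suc n)"])
    then show "t n \<in> local_domain_nest M E \<N>" using local t' by blast
    from le show "AE x in M. t n x \<le> \<bar>f x\<bar>" by eventually_elim (auto simp: t_def)
  qed (simp add: t_def)
  have "E (\<lambda>x. max 0 (g x)) \<le> E' g"
  proof (rule E.E_le_if_pointwise_limit)
    show "t n \<in> L0 M" for n by (rule E.D_measurable[OF t])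
    show "E (t n) \<le> E' g" for n
      using E'.E_clamp_le[of g "real (Suc n)"] extension_eq[OF t[of n]] by (simp add: t_def[abs_def])
    show "AE x in M. (\<lambda>n. t n x) \<longlonglongrightarrow> max 0 (g x)"
    proof (rule AE_I2, rule tendsto_eventually)
      fix x
      obtain m where "g x \<le> real m" using real_arch_simple by blast
      then show "\<forall>\<^sub>F n in sequentially. t n x = max 0 (g x)"
        by (intro eventually_sequentiallyI[of m]) (auto simp: t_def)
    qed
  qed measurable
  then show "(\<lambda>x. max 0 (g x)) \<in> form_domain M E"
    by (rule E.D_I[rotated]) (use E'.D_finite[OF g] in auto)
qed

end

theorem theorem3p2:
  fixes M :: "'a measure"
    and E E' :: "('a \<Rightarrow> real) \<Rightarrow> ennreal"
  assumes "localizable M"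
    and "energy_form M E"
    and "energy_form M E'"
    and "form_extension M E E'"
  shows "
    (order_ideal_in M (form_domain M E) (form_domain M E') \<longleftrightarrow>
     algebraic_ideal_in (form_domain M E \<inter> Linf M) (form_domain M E' \<inter> Linf M)) \<and>
    (order_ideal_in M (form_domain M E) (form_domain M E') \<longleftrightarrow>
     form_domain M E' \<subseteq> local_domain M E) \<and>
    (order_ideal_in M (form_domain M E) (form_domain M E') \<longleftrightarrow>
     (\<exists>\<N>. special_nest M E \<N> \<and> form_domain M E' \<inter> Linf M \<subseteq> local_domain_nest M E \<N>)) \<and>
    (order_ideal_in M (form_domain M E) (form_domain M E') \<longleftrightarrow>
     (\<forall>\<N>. special_nest M E \<N> \<longrightarrow> form_domain M E' \<inter> Linf M \<subseteq> local_domain_nest M E \<N>))"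
proof -
  interpret energy_extension M E E'
    using assms
    by unfold_locales (auto simp: localizable_def energy_form_def markovian_form_def)
  \<comment> \<open>Two cycles through (i): (i), (ii), (v), (iv), where the existence of a special
    nest leads from (v) to (iv), and (i), (iii).\<close>
  show ?thesis
    using order_ideal_imp_algebraic_ideal algebraic_ideal_imp_local order_ideal_imp_local
      local_imp_order_ideal special_nest_imp_order_ideal E.special_nest_exists
    by metis
qed

end
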